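(* The structure $(\mathfrak R,\prec)$ is Ramsey.
   Context: Let $\mathfrak S$ be the structure with domain $2^{\mathbb N}\setminus\{\emptyset\}$ and five binary relations: $(x,y)\in\mathtt{EQ}$ iff $x=y$; $(x,y)\in\mathtt{PP}$ iff $x\subsetneq y$; $(x,y)\in\mathtt{PPI}$ iff $x\supsetneq y$; $(x,y)\in\mathtt{DR}$ iff $x\cap y=\emptyset$; $(x,y)\in\mathtt{PO}$ iff $x\not\subseteq y$, $y\not\subseteq x$ and $x\cap y\ne\emptyset$. The age of a structure is the class of all finite structures that embed into it. A structure is homogeneous if every isomorphism between finite substructures extends to an automorphism. Let $\mathcal C$ be the class of all expansions of structures from $\operatorname{Age}(\mathfrak S)$ to the signature $\{\mathtt{EQ},\mathtt{DR},\mathtt{PO},\mathtt{PP},\mathtt{PPI},\prec\}$ such that $\prec$ is a (strict) linear order extending $\mathtt{PP}$. The class $\mathcal C$ is an amalgamation class, and $(\mathfrak R,\prec)$ denotes its Fraïssé limit, i.e., the (unique up to isomorphism) countable homogeneous structure whose age is $\mathcal C$. For structures $\mathfrak A,\mathfrak B$ in the same signature, $\binom{\mathfrak B}{\mathfrak A}$ is the set of embeddings of $\mathfrak A$ into $\mathfrak B$. For $r\in\mathbb N$, $\mathfrak C\to(\mathfrak B)^{\mathfrak A}_r$ means that for every $\chi\colon\binom{\mathfrak C}{\mathfrak A}\to\{1,\dots,r\}$ there exists $e\in\binom{\mathfrak C}{\mathfrak B}$ such that $\chi$ is constant on $\{e\circ f: f\in\binom{\mathfrak B}{\mathfrak A}\}$.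 A class $\mathcal K$ of finite structures has the Ramsey property if for all $\mathfrak A,\mathfrak B\in\mathcal K$ and $r\in\mathbb N$ there is $\mathfrak C\in\mathcal K$ with $\mathfrak C\to(\mathfrak B)^{\mathfrak A}_r$. A homogeneous structure is Ramsey if its age has the Ramsey property. *)

theory Defs
  imports "HOL-Library.FuncSet" "HOL-Library.Countable_Set"
begin

section \<open>Binary relational structures\<close>

text \<open>
  The signature is the type \<open>'s\<close> of relation symbols, all of them binary.
  Relations live on the carrier (\<open>is_structure\<close>); the empty structure is allowed.
\<close>

record ('s, 'a) bstruct =
  carrier :: "'a set"
  rel :: "'s \<Rightarrow> ('a \<times> 'a) set"

definition is_structure :: "('s, 'a) bstruct \<Rightarrow> bool" where
  "is_structure A \<longleftrightarrow> (\<forall>s. rel A s \<subseteq> carrier A \<times> carrier A)"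

text \<open>
  Embeddings of \<open>A\<close> into \<open>B\<close>. They are made extensional, so that distinct elements of the
  set are distinct as functions on the carrier of \<open>A\<close>.
\<close>

definition embeddings :: "('s, 'a) bstruct \<Rightarrow> ('s, 'b) bstruct \<Rightarrow> ('a \<Rightarrow> 'b) set" where
  "embeddings A B = {f \<in> carrier A \<rightarrow>\<^sub>E carrier B. inj_on f (carrier A) \<and>
     (\<forall>s. \<forall>x\<in>carrier A. \<forall>y\<in>carrier A. (x, y) \<in> rel A s \<longleftrightarrow> (f x, f y) \<in> rel B s)}"

definition isomorphisms :: "('s, 'a) bstruct \<Rightarrow> ('s, 'b) bstruct \<Rightarrow> ('a \<Rightarrow> 'b) set" where
  "isomorphisms A B = {f \<in> embeddings A B. f ` carrier A = carrier B}"

definition substructure :: "('s, 'a) bstruct \<Rightarrow> 'a set \<Rightarrow> ('s, 'a) bstruct" where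
  "substructure A X = \<lparr>carrier = X, rel = (\<lambda>s. rel A s \<inter> X \<times> X)\<rparr>"

text \<open>
  Every finite structure is isomorphic to one whose elements are natural numbers, so
  isomorphism-closed classes of finite structures are represented as sets of structures with
  carriers in \<^typ>\<open>nat\<close>.
\<close>

definition age :: "('s, 'a) bstruct \<Rightarrow> ('s, nat) bstruct set" where
  "age M = {A. is_structure A \<and> finite (carrier A) \<and> embeddings A M \<noteq> {}}"

definition homogeneous :: "('s, 'a) bstruct \<Rightarrow> bool" where
  "homogeneous M \<longleftrightarrow>
     (\<forall>X Y f. finite X \<and> X \<subseteq> carrier M \<and> finite Y \<and> Y \<subseteq> carrier M \<and>
        f \<in> isomorphisms (substructure M X) (substructure M Y) \<longrightarrow>
        (\<exists>g \<in> isomorphisms M M. \<forall>x\<in>X. g x = f x))"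

definition is_fraisse_limit :: "('s, 'a) bstruct \<Rightarrow> ('s, nat) bstruct set \<Rightarrow> bool" where
  "is_fraisse_limit M K \<longleftrightarrow>
     is_structure M \<and> countable (carrier M) \<and> homogeneous M \<and> age M = K"


section \<open>The Ramsey property\<close>

definition ramsey_arrow ::
  "('s, 'c) bstruct \<Rightarrow> ('s, 'b) bstruct \<Rightarrow> ('s, 'a) bstruct \<Rightarrow> nat \<Rightarrow> bool" where
  "ramsey_arrow C B A r \<longleftrightarrow>
     (\<forall>\<chi> \<in> embeddings A C \<rightarrow> {1..r}. \<exists>e \<in> embeddings B C.
        \<exists>c. \<forall>f \<in> embeddings A B. \<chi> (compose (carrier A) e f) = c)"

definition ramsey_property :: "('s, nat) bstruct set \<Rightarrow> bool" where
  "ramsey_property K \<longleftrightarrow> (\<forall>A\<in>K. \<forall>B\<in>K. \<forall>r. \<exists>C\<in>K. ramsey_arrow C B A r)"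

definition ramsey_structure :: "('s, 'a) bstruct \<Rightarrow> bool" where
  "ramsey_structure M \<longleftrightarrow> homogeneous M \<and> ramsey_property (age M)"


section \<open>The set structure and its ordered expansions\<close>

datatype rcc5 = EQ | PP | PPI | DR | PO

datatype ordered_rcc5 = Base rcc5 | Prec

fun set_rel :: "rcc5 \<Rightarrow> nat set \<Rightarrow> nat set \<Rightarrow> bool" where
  "set_rel EQ x y \<longleftrightarrow> x = y"
| "set_rel PP x y \<longleftrightarrow> x \<subset> y"
| "set_rel PPI x y \<longleftrightarrow> x \<supset> y"
| "set_rel DR x y \<longleftrightarrow> x \<inter> y = {}"
| "set_rel PO x y \<longleftrightarrow> \<not> x \<subseteq> y \<and> \<not> y \<subseteq> x \<and> x \<inter> y \<noteq> {}"

definition set_structure :: "(rcc5, nat set) bstruct" where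
  "set_structure =
     \<lparr>carrier = UNIV - {{}},
      rel = (\<lambda>s. {(x, y). x \<noteq> {} \<and> y \<noteq> {} \<and> set_rel s x y})\<rparr>"

definition rcc5_reduct :: "(ordered_rcc5, 'a) bstruct \<Rightarrow> (rcc5, 'a) bstruct" where
  "rcc5_reduct A = \<lparr>carrier = carrier A, rel = (\<lambda>s. rel A (Base s))\<rparr>"

definition ordered_class :: "(ordered_rcc5, nat) bstruct set" where
  "ordered_class = {A. is_structure A \<and> rcc5_reduct A \<in> age set_structure \<and>
     strict_linear_order_on (carrier A) (rel A Prec) \<and> rel A (Base PP) \<subseteq> rel A Prec}"

end

theory Submission
  imports Defs "HOL-Library.Nat_Bijection"
begin

text \<open>
  Homogeneity is part of being a Fraisse limit, so the theorem says that the class of finite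
  ordered set structures has the Ramsey property. This is deduced from the dual Ramsey theorem,
  that is, the theorem of Graham and Rothschild for parameter words over the empty alphabet: for
  every colouring of the rigid surjections \<open>n \<rightarrow> d\<close>, with \<open>n\<close> large enough, there is a rigid
  surjection \<open>f: n \<rightarrow> e\<close> such that all compositions of \<open>f\<close> with rigid surjections \<open>e \<rightarrow> d\<close> have
  the same colour. (A surjection of finite linear orders is rigid if the least preimages of the
  elements of its target are in increasing order.)

  The translation is contravariant. To a structure \<open>A\<close> belongs the set of its linked upsets: the
  sets of elements that are closed upwards under inclusion and contain no two disjoint elements.
  A map from \<open>{..<n}\<close> onto the linked upsets of \<open>A\<close> turns each element \<open>x\<close> into the set of those
  \<open>i\<close> whose upset contains \<open>x\<close>, and this embeds \<open>A\<close> into the nonempty subsets of \<open>{..<n}\<close>. An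
  embedding of \<open>A\<close> into \<open>B\<close> induces, by restriction, a surjection from the linked upsets of \<open>B\<close>
  onto those of \<open>A\<close>. Linear orders fit into this picture if both the subsets of \<open>{..<n}\<close> and
  the linked upsets are ordered lexicographically, the latter with respect to the order of \<open>A\<close>:
  then the map given by a rigid surjection preserves the order (\<open>word_embedding\<close>), and restriction
  is rigid (\<open>restriction_word\<close>). A colouring of the copies of \<open>A\<close> among the subsets of \<open>{..<n}\<close>
  thus becomes a colouring of rigid surjections, and the surjection \<open>f\<close> that the theorem of Graham and
  Rothschild provides becomes the required copy of \<open>B\<close>.

  The theorem \<open>graham_rothschild\<close> is proved by induction on the number of parameters of the words
  that are coloured. A word with \<open>k + 1\<close> parameters over an alphabet consists of a prefix without
  parameters, the first parameter, and a rest with \<open>k\<close> parameters over the alphabet enlarged by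
  the first one. By induction the colour can be made independent of the rest
  (\<open>depends_on_prefix\<close>); by the theorem of Hales and Jewett, which is also the base case and is
  proved by colour focusing, it can be made independent of everything but the length of the
  prefix (\<open>depends_on_prefix_length\<close>); and the pigeonhole principle selects many prefix lengths
  of the same colour.
\<close>

section \<open>Parameter words\<close>

text \<open>
  \<open>pword c w d\<close>: the letters below \<open>c\<close> are constants, \<open>c, \<dots>, d - 1\<close> are parameters, and
  every parameter occurs in \<open>w\<close>, the first occurrences being in increasing order. The
  recursion reads \<open>w\<close> from left to right and lets \<open>c\<close> count the letters that are already
  available, so that the definition splits along concatenation. For \<open>c = 0\<close> these words are the
  rigid surjections from positions onto \<open>{..<d}\<close>.
\<close>

fun pword :: "nat \<Rightarrow> nat list \<Rightarrow> nat \<Rightarrow> bool" where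
  "pword c [] d \<longleftrightarrow> c = d"
| "pword c (x # w) d \<longleftrightarrow> x < c \<and> pword c w d \<or> x = c \<and> pword (Suc c) w d"

text \<open>
  Replacing the parameters of \<open>w\<close> by the letters of \<open>v\<close>. Words over \<open>{..<c}\<close> with parameters
  are thus composed like rigid surjections that fix \<open>{..<c}\<close> pointwise.
\<close>

definition subst :: "nat \<Rightarrow> nat list \<Rightarrow> nat list \<Rightarrow> nat list" where
  "subst c v w = map (\<lambda>i. if i < c then i else v ! (i - c)) w"

lemma pword_append: "pword c (u @ v) d \<longleftrightarrow> (\<exists>e. pword c u e \<and> pword e v d)"
  by (induction u arbitrary: c) auto

lemma pword_le: "pword c w d \<Longrightarrow> c \<le> d"
  by (induction w arbitrary: c) (auto dest: Suc_leD)

lemma pword_letter_less: "pword c w d \<Longrightarrow> x \<in> set w \<Longrightarrow> x < d"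
  by (induction w arbitrary: c) (fastforce dest: pword_le)+

lemma pword_const_iff: "pword c w c \<longleftrightarrow> set w \<subseteq> {..<c}"
proof
  show "pword c w c \<Longrightarrow> set w \<subseteq> {..<c}" using pword_letter_less by blast
  show "set w \<subseteq> {..<c} \<Longrightarrow> pword c w c" by (induction w) auto
qed

lemma length_subst [simp]: "length (subst c v w) = length w"
  by (simp add: subst_def)

lemma subst_append [simp]: "subst c v (u @ w) = subst c v u @ subst c v w"
  by (simp add: subst_def)

lemma subst_Nil [simp]: "subst c v [] = []"
  by (simp add: subst_def)

lemma subst_Cons: "subst c v (x # w) = (if x < c then x else v ! (x - c)) # subst c v w"
  by (simp add: subst_def)

lemma subst_const: "set w \<subseteq> {..<c} \<Longrightarrow> subst c v w = w"
  by (auto simp: subst_def intro!: map_idI)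

lemma subst_prefix:
  assumes "\<And>x. x \<in> set w \<Longrightarrow> x < c + length v"
  shows "subst c (v @ v') w = subst c v w"
  unfolding subst_def
proof (rule map_cong[OF refl])
  fix x assume "x \<in> set w"
  with assms have "x < c + length v" by blast
  then show "(if x < c then x else (v @ v') ! (x - c)) = (if x < c then x else v ! (x - c))"
    by (auto simp: nth_append)
qed

text \<open>
  If the first parameter is replaced by itself, it might as well be a constant. This is how the
  alphabet grows in the induction for the Graham-Rothschild theorem.
\<close>

lemma subst_parameter_as_letter: "subst c (c # v) w = subst (Suc c) v w"
  unfolding subst_def
proof (rule map_cong[OF refl])
  fix x
  show "(if x < c then x else (c # v) ! (x - c)) = (if x < Suc c then x else v ! (x - Suc c))"
  proof (cases "x \<le> c")
    case False
    then have "x - c = Suc (x - Suc c)" by simp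
    with False show ?thesis by simp
  qed (auto simp: le_less)
qed

text \<open>
  A word over the alphabet \<open>{..<c}\<close>, read over the larger alphabet \<open>{..<Suc c}\<close>: the new constant
  \<open>c\<close> does not occur, and every parameter moves up by one.
\<close>

definition skip_letter :: "nat \<Rightarrow> nat list \<Rightarrow> nat list" where
  "skip_letter c w = map (\<lambda>i. if i < c then i else Suc i) w"

lemma pword_skip_letter: "pword e w d \<Longrightarrow> c \<le> e \<Longrightarrow> pword (Suc e) (skip_letter c w) (Suc d)"
  by (induction w arbitrary: e) (auto simp: skip_letter_def)

lemma subst_subst:
  assumes "\<And>x. x \<in> set u \<Longrightarrow> x < c + length w"
  shows "subst c v (subst c w u) = subst c (subst c v w) u"
proof -
  have "(subst c v w) ! (x - c) = (if w ! (x - c) < c then w ! (x - c) else v ! (w ! (x - c) - c))"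
    if "x \<in> set u" "\<not> x < c" for x
  proof -
    have "x - c < length w" using assms[OF that(1)] that(2) by linarith
    then show ?thesis by (simp add: subst_def)
  qed
  then show ?thesis by (auto simp: subst_def)
qed

text \<open>
  Reading \<open>w\<close> from left to right, the parameters \<open>c, \<dots>, c + length v1 - 1\<close> have been met already,
  so substitution has produced exactly the letters of \<open>v1\<close>; a first occurrence of the next
  parameter of \<open>w\<close> contributes the next letter of \<open>v2\<close>.
\<close>

lemma pword_subst_aux:
  assumes "pword (c + length v1) w (c + length v1 + length v2)" "pword c v1 m" "pword m v2 d"
  shows "pword m (subst c (v1 @ v2) w) d"
  using assms
proof (induction w arbitrary: v1 v2 m)
  case Nil
  then show ?case by simp
next
  case (Cons x w)
  have cm: "c \<le> m" using Cons.prems(2) by (rule pword_le)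
  from Cons.prems(1) consider
    (old) "x < c + length v1" "pword (c + length v1) w (c + length v1 + length v2)"
    | (new) "x = c + length v1" "pword (Suc (c + length v1)) w (c + length v1 + length v2)"
    by auto
  then show ?case
  proof cases
    case old
    have "(if x < c then x else (v1 @ v2) ! (x - c)) < m"
    proof (cases "x < c")
      case False
      then have "v1 ! (x - c) \<in> set v1" "x - c < length v1" using old(1) by auto
      then show ?thesis using False Cons.prems(2) pword_letter_less by (auto simp: nth_append)
    qed (use cm in auto)
    with Cons.IH[OF old(2) Cons.prems(2,3)] show ?thesis by (simp add: subst_Cons)
  next
    case new
    then obtain y v3 where v2: "v2 = y # v3" using pword_le[OF new(2)] by (cases v2) auto
    let ?m = "if y < m then m else Suc m"
    from Cons.prems(3) v2 have y: "y < m \<and> pword m v3 d \<or> y = m \<and> pword (Suc m) v3 d" by simp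
    then have "pword c (v1 @ [y]) ?m" "pword ?m v3 d"
      using Cons.prems(2) by (auto simp: pword_append)
    then have "pword ?m (subst c ((v1 @ [y]) @ v3) w) d"
      using new(2) v2 by (intro Cons.IH) auto
    then show ?thesis using y new(1) v2 by (auto simp: subst_Cons nth_append)
  qed
qed

lemma pword_subst:
  assumes "pword c w (c + length v)" "pword c v d"
  shows "pword c (subst c v w) d"
  using pword_subst_aux[of c "[]" w v c d] assms by simp

lemma pword_split:
  assumes "pword c w d" "c \<le> e" "e < d"
  obtains u v where "w = u @ e # v" "pword c u e" "pword (Suc e) v d"
proof -
  have "\<exists>u v. w = u @ e # v \<and> pword c u e \<and> pword (Suc e) v d"
    using assms
  proof (induction w arbitrary: c)
    case (Cons x w)
    show ?case
    proof (cases "x = c \<and> c = e")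
      case True
      then have "pword (Suc e) w d" using Cons.prems by auto
      with True show ?thesis by (intro exI[of _ "[]"] exI[of _ w]) auto
    next
      case False
      then obtain c' where c': "x < c \<and> c' = c \<or> x = c \<and> c' = Suc c" "pword c' w d" "c' \<le> e"
        using Cons.prems by fastforce
      from Cons.IH[OF c'(2,3) Cons.prems(3)] obtain u v where
        "w = u @ e # v" "pword c' u e" "pword (Suc e) v d" by blast
      then show ?thesis using c'(1) by (intro exI[of _ "x # u"] exI[of _ v]) auto
    qed
  qed simp
  then show ?thesis using that by blast
qed

lemma pword_surj:
  assumes "pword c w d" "c \<le> j" "j < d"
  shows "j \<in> set w"
  by (rule pword_split[OF assms]) auto

lemma pword_first_occurrences_increasing:
  "pword c w d \<Longrightarrow> i < length w \<Longrightarrow> c \<le> j \<Longrightarrow> j < w ! i \<Longrightarrow> \<exists>i'<i. w ! i' = j"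
proof (induction w arbitrary: c i)
  case (Cons x w)
  then obtain k where k: "i = Suc k" by (cases i) auto
  show ?case
  proof (cases "x = j")
    case True
    then show ?thesis using k by (intro exI[of _ 0]) simp
  next
    case False
    with Cons.prems obtain c' where "pword c' w d" "c' \<le> j" by fastforce
    from Cons.IH[OF this(1) _ this(2), of k] Cons.prems k obtain i' where "i' < k" "w ! i' = j" by auto
    then show ?thesis using k by (intro exI[of _ "Suc i'"]) simp
  qed
qed simp

text \<open>
  Together with \<open>pword_letter_less\<close>, \<open>pword_surj\<close> and \<open>pword_first_occurrences_increasing\<close> this
  shows that the recursive definition captures rigidity.
\<close>

lemma pwordI:
  assumes "c \<le> d" "\<And>x. x \<in> set w \<Longrightarrow> x < d" "\<And>j. c \<le> j \<Longrightarrow> j < d \<Longrightarrow> j \<in> set w"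
    and "\<And>i j. i < length w \<Longrightarrow> c \<le> j \<Longrightarrow> j < w ! i \<Longrightarrow> \<exists>i'<i. w ! i' = j"
  shows "pword c w d"
  using assms
proof (induction w arbitrary: c)
  case Nil
  then show ?case by (metis empty_iff le_neq_implies_less list.set(1) order_refl pword.simps(1))
next
  case (Cons x w)
  have "x \<le> c" using Cons.prems(4)[of 0 c] by fastforce
  define c' where "c' = (if x = c then Suc c else c)"
  have "x < c'" using \<open>x \<le> c\<close> by (auto simp: c'_def)
  have "c \<le> c'" by (simp add: c'_def)
  have "pword c' w d"
  proof (rule Cons.IH)
    show "c' \<le> d" using Cons.prems(1,2) by (auto simp: c'_def Suc_le_eq)
    show "y < d" if "y \<in> set w" for y using that Cons.prems(2) by simp
    show "j \<in> set w" if "c' \<le> j" "j < d" for j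
      using Cons.prems(3)[of j] that \<open>x < c'\<close> \<open>c \<le> c'\<close> by auto
    show "\<exists>i'<i. w ! i' = j" if ij: "i < length w" "c' \<le> j" "j < w ! i" for i j
    proof -
      obtain i' where i': "i' < Suc i" "(x # w) ! i' = j"
        using Cons.prems(4)[of "Suc i" j] ij \<open>c \<le> c'\<close> by auto
      then obtain k where "i' = Suc k" using ij \<open>x < c'\<close> by (cases i') auto
      with i' show ?thesis by auto
    qed
  qed
  then show ?case using \<open>x \<le> c\<close> by (auto simp: c'_def split: if_splits)
qed

text \<open>
  Where \<open>subst c (h @ c # g) f\<close> has its first letter \<open>c\<close>, the word \<open>f\<close> has the first
  occurrence of its parameter number \<open>length h\<close>. Up to there \<open>f\<close> contains only the parameters
  that \<open>h\<close> replaces, so the prefix before the first \<open>c\<close> does not depend on \<open>g\<close>.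
\<close>

lemma subst_first_parameter:
  assumes "pword c f (c + m)" "set h \<subseteq> {..<c}" "length h < m"
  obtains h' where "set h' \<subseteq> {..<c}"
    "\<And>g. length h + Suc (length g) = m \<Longrightarrow> \<exists>g'. subst c (h @ c # g) f = h' @ c # g'"
proof -
  have "c \<le> c + length h" "c + length h < c + m" using assms(3) by auto
  then obtain u v where uv: "f = u @ (c + length h) # v" "pword c u (c + length h)"
    using pword_split[OF assms(1)] by metis
  have "pword c (subst c h u) c"
    using pword_subst[OF uv(2)] assms(2) pword_const_iff by blast
  moreover have "subst c (h @ c # g) f = subst c h u @ c # subst c (h @ c # g) v" for g
    using subst_prefix[of u c h "c # g"] pword_letter_less[OF uv(2)]
    by (auto simp: uv(1) subst_Cons nth_append)
  ultimately show ?thesis using that pword_const_iff by blast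
qed

lemma takeWhile_first_parameter:
  fixes c :: nat
  assumes "set h \<subseteq> {..<c}"
  shows "takeWhile (\<lambda>x. x < c) (h @ c # g) = h"
  using assms by (auto simp: takeWhile_append subset_iff)

lemma pword_first_parameter:
  assumes "pword c w d" "c < d"
  obtains h g where "w = h @ c # g" "set h \<subseteq> {..<c}" "pword (Suc c) g d"
  using pword_split[OF assms(1) order_refl assms(2)] pword_const_iff by metis

section \<open>The Hales-Jewett theorem\<close>

text \<open>
  The partition relation of Graham and Rothschild: colours from \<open>S\<close> are given to the words of
  length \<open>n\<close> with \<open>d - c\<close> parameters, and some word \<open>f\<close> with \<open>m\<close> parameters (an \<open>m\<close>-dimensional
  subspace) has all its specialisations to \<open>d - c\<close> parameters in one colour.
\<close>

definition monochromatic_subspace :: "nat \<Rightarrow> nat \<Rightarrow> nat \<Rightarrow> nat set \<Rightarrow> nat \<Rightarrow> bool" where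
  "monochromatic_subspace c d m S n \<longleftrightarrow>
     (\<forall>\<chi>. (\<forall>w. pword c w d \<and> length w = n \<longrightarrow> \<chi> w \<in> S) \<longrightarrow>
       (\<exists>f \<kappa>. pword c f (c + m) \<and> length f = n \<and>
         (\<forall>g. pword c g d \<and> length g = m \<longrightarrow> \<chi> (subst c g f) = \<kappa>)))"

lemma monochromatic_subspaceE:
  assumes "monochromatic_subspace c d m S n" "\<And>w. pword c w d \<Longrightarrow> length w = n \<Longrightarrow> \<chi> w \<in> S"
  obtains f \<kappa> where "pword c f (c + m)" "length f = n"
    "\<forall>g. pword c g d \<and> length g = m \<longrightarrow> \<chi> (subst c g f) = \<kappa>"
  using assms unfolding monochromatic_subspace_def by metis

text \<open>
  A finite family of colourings becomes a single one when the tuple of colours is coded as a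
  number; the code can be inverted on the index set.
\<close>

definition pack :: "'i list \<Rightarrow> ('i \<Rightarrow> nat) \<Rightarrow> nat" where
  "pack L \<phi> = to_nat (map \<phi> L)"

definition unpack :: "'i list \<Rightarrow> nat \<Rightarrow> 'i \<Rightarrow> nat" where
  "unpack L k i = the (map_of (zip L (from_nat k :: nat list)) i)"

lemma unpack_pack: "i \<in> set L \<Longrightarrow> unpack L (pack L \<phi>) i = \<phi> i"
  by (simp add: unpack_def pack_def map_of_zip_map)

lemma packed_colours:
  fixes S :: "nat set"
  assumes "finite S" "S \<noteq> {}"
  obtains S' where "finite S'" "S' \<noteq> {}" "\<forall>\<phi>. \<phi> ` set L \<subseteq> S \<longrightarrow> pack L \<phi> \<in> S'"
proof -
  define T where "T = {xs :: nat list. set xs \<subseteq> S \<and> length xs = length L}"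
  obtain s where "s \<in> S" using assms(2) by blast
  then have "replicate (length L) s \<in> T" by (auto simp: T_def)
  then have "to_nat ` T \<noteq> {}" by blast
  moreover have "finite (to_nat ` T)"
    unfolding T_def using finite_lists_length_eq[OF assms(1)] by auto
  moreover have "pack L \<phi> \<in> to_nat ` T" if "\<phi> ` set L \<subseteq> S" for \<phi>
    unfolding pack_def T_def using that by (intro imageI) auto
  ultimately show ?thesis using that by metis
qed

lemma finite_constant_words: "finite {h. pword c h c \<and> length h = n}"
  using finite_lists_length_eq[of "{..<c}" n] by (simp add: pword_const_iff)

lemma pword_mono_const: "pword c h c \<Longrightarrow> c \<le> d \<Longrightarrow> pword d h d"
  by (auto simp: pword_const_iff)

text \<open>
  Lines over the alphabet \<open>{..<Suc c}\<close> are words with the single parameter \<open>Suc c\<close>.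
\<close>

definition monochromatic_line :: "nat \<Rightarrow> nat \<Rightarrow> (nat list \<Rightarrow> nat) \<Rightarrow> bool" where
  "monochromatic_line c n \<chi> \<longleftrightarrow>
     (\<exists>f \<kappa>. pword (Suc c) f (Suc (Suc c)) \<and> length f = n \<and>
       (\<forall>x\<le>c. \<chi> (subst (Suc c) [x] f) = \<kappa>))"

text \<open>
  The lines of \<open>q\<close> different colours that meet in their last point \<open>z\<close>, each monochromatic up to
  that point. If \<open>z\<close> had one of these colours, the corresponding line would be monochromatic
  altogether; this is why \<open>\<chi> z \<notin> Q\<close> may be demanded.
\<close>

definition focused_lines :: "nat \<Rightarrow> nat \<Rightarrow> nat \<Rightarrow> nat set \<Rightarrow> (nat list \<Rightarrow> nat) \<Rightarrow> bool" where
  "focused_lines c n q S \<chi> \<longleftrightarrow>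
    (\<exists>z Q. pword (Suc c) z (Suc c) \<and> length z = n \<and> Q \<subseteq> S \<and> card Q = q \<and> \<chi> z \<notin> Q \<and>
       (\<forall>\<kappa>\<in>Q. \<exists>f. pword (Suc c) f (Suc (Suc c)) \<and> length f = n \<and> subst (Suc c) [c] f = z \<and>
          (\<forall>x<c. \<chi> (subst (Suc c) [x] f) = \<kappa>)))"

text \<open>
  Colour focusing. In a product of two cubes, the Hales-Jewett theorem for the smaller alphabet
  yields a line \<open>l\<close> in the second factor on which, up to the last point, the induced colouring of
  the whole first factor is constant. If \<open>\<chi>1\<close>, this induced colouring, has \<open>q\<close> focused lines
  in the first factor, they are prolonged by moving along \<open>l\<close> simultaneously, and a new line
  arises by standing still at the focus \<open>z\<close> in the first factor and moving along \<open>l\<close>. Its colour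
  \<open>\<chi>1 z\<close> is new, and all \<open>q + 1\<close> lines end in \<open>z\<close> followed by the last point of \<open>l\<close>.
\<close>

lemma monochromatic_or_focused_lines:
  assumes line: "\<And>S. finite S \<Longrightarrow> S \<noteq> {} \<Longrightarrow> \<exists>n. monochromatic_subspace c c 1 S n"
    and "0 < c" "finite S" "S \<noteq> {}"
  shows "\<exists>n. \<forall>\<chi>. (\<forall>w. pword (Suc c) w (Suc c) \<and> length w = n \<longrightarrow> \<chi> w \<in> S) \<longrightarrow>
    monochromatic_line c n \<chi> \<or> focused_lines c n q S \<chi>"
    (is "\<exists>n. \<forall>\<chi>. ?col n \<chi> \<longrightarrow> _ \<or> _")
proof (induction q)
  case 0
  have "focused_lines c 0 0 S \<chi>" for \<chi>
    unfolding focused_lines_def by (intro exI[of _ "[]"] exI[of _ "{}"]) auto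
  then show ?case by blast
next
  case (Suc q)
  then obtain n1 where n1: "\<And>\<chi>. ?col n1 \<chi> \<Longrightarrow> monochromatic_line c n1 \<chi> \<or> focused_lines c n1 q S \<chi>" by blast
  let ?U = "{u. pword (Suc c) u (Suc c) \<and> length u = n1}"
  obtain L where L: "set L = ?U" using finite_list[OF finite_constant_words[of "Suc c" n1]] by blast
  define enc where "enc = pack L"
  define dec where "dec = unpack L"
  obtain S' where S': "finite S'" "S' \<noteq> {}"
    and enc: "\<forall>\<phi>. \<phi> ` ?U \<subseteq> S \<longrightarrow> enc \<phi> \<in> S'"
    unfolding enc_def by (rule packed_colours[OF assms(3,4), of L, unfolded L])
  have dec: "dec (enc \<phi>) u = \<phi> u" if "u \<in> ?U" for \<phi> u
    unfolding enc_def dec_def using that L unpack_pack[of u L \<phi>] by simp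
  obtain n2 where n2: "monochromatic_subspace c c 1 S' n2" using line S' by blast
  have "monochromatic_line c (n1 + n2) \<chi> \<or> focused_lines c (n1 + n2) (Suc q) S \<chi>" if col: "?col (n1 + n2) \<chi>" for \<chi>
  proof (cases "monochromatic_line c (n1 + n2) \<chi>")
    case False
    have *: "enc (\<lambda>u. \<chi> (u @ v)) \<in> S'" if "pword c v c" "length v = n2" for v
    proof (rule enc[rule_format], rule image_subsetI)
      fix u assume "u \<in> ?U"
      with that show "\<chi> (u @ v) \<in> S"
        using pword_mono_const[OF that(1), of "Suc c"] by (intro col[rule_format]) (auto simp: pword_append)
    qed
    obtain l \<kappa>0 where l: "pword c l (c + 1)" "length l = n2"
      and \<kappa>0: "\<forall>g. pword c g c \<and> length g = 1 \<longrightarrow> enc (\<lambda>u. \<chi> (u @ subst c g l)) = \<kappa>0"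
      by (rule monochromatic_subspaceE[OF n2, of "\<lambda>v. enc (\<lambda>u. \<chi> (u @ v))", OF *])
    define l' where "l' = skip_letter c l"
    have l_less: "x \<le> c" if "x \<in> set l" for x using pword_letter_less[OF l(1) that] by simp
    have l': "pword (Suc (Suc c)) l' (Suc (Suc c))" "length l' = n2"
      using l_less l(2) by (force simp: l'_def skip_letter_def pword_const_iff)+
    have sub_l': "subst (Suc c) [x] l' = subst c [x] l" for x
      using l_less by (fastforce simp: subst_def l'_def skip_letter_def)
    \<comment> \<open>The last point of the line is \<open>l\<close> itself, whose parameter \<open>c\<close> becomes the new constant.\<close>
    have sub_l'_c: "subst (Suc c) [c] l' = l"
      using l_less by (force simp: subst_def l'_def skip_letter_def intro!: map_idI)
    have l'_line: "pword (Suc c) l' (Suc (Suc c))"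
      using pword_skip_letter[OF l(1) order_refl] by (simp add: l'_def)
    define \<chi>1 where "\<chi>1 u = \<chi> (u @ subst c [0] l)" for u
    have const_l: "pword c (subst c [x] l) c" if "x < c" for x
      using that l(1) pword_subst[of c l "[x]" c] by simp
    have col1: "\<chi> (u @ subst c [x] l) = \<chi>1 u" if "u \<in> ?U" "x < c" for u x
    proof -
      have "enc (\<lambda>u. \<chi> (u @ subst c [x] l)) = enc (\<lambda>u. \<chi> (u @ subst c [0] l))"
        using \<kappa>0[rule_format, of "[x]"] \<kappa>0[rule_format, of "[0]"] that(2) by simp
      from dec[OF that(1), of "\<lambda>u. \<chi> (u @ subst c [x] l)", unfolded this] dec[OF that(1)]
      show ?thesis by (simp add: \<chi>1_def)
    qed
    have "?col n1 \<chi>1"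
      unfolding \<chi>1_def using l(2) pword_mono_const[OF const_l[OF \<open>0 < c\<close>], of "Suc c"]
      by (intro allI impI col[rule_format]) (auto simp: pword_append)
    then consider "monochromatic_line c n1 \<chi>1" | "focused_lines c n1 q S \<chi>1" using n1 by blast
    then show ?thesis
    proof cases
      case 1
      then obtain f \<kappa> where f: "pword (Suc c) f (Suc (Suc c))" "length f = n1"
        "\<And>x. x \<le> c \<Longrightarrow> \<chi>1 (subst (Suc c) [x] f) = \<kappa>"
        unfolding monochromatic_line_def by blast
      let ?l0 = "subst c [0] l"
      have "pword (Suc c) (f @ ?l0) (Suc (Suc c))"
        using f(1) pword_mono_const[OF const_l[OF \<open>0 < c\<close>]] by (auto simp: pword_append)
      moreover have "subst (Suc c) [x] ?l0 = ?l0" for x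
        using const_l[OF \<open>0 < c\<close>] by (intro subst_const) (auto simp: pword_const_iff)
      ultimately have "monochromatic_line c (n1 + n2) \<chi>"
        unfolding monochromatic_line_def using f l(2) by (intro exI[of _ "f @ ?l0"] exI[of _ \<kappa>]) (auto simp: \<chi>1_def)
      with False show ?thesis by blast
    next
      case 2
      then obtain z Q where z: "pword (Suc c) z (Suc c)" "length z = n1"
        and Q: "Q \<subseteq> S" "card Q = q" "\<chi>1 z \<notin> Q"
        and lines: "\<And>\<kappa>. \<kappa> \<in> Q \<Longrightarrow> \<exists>f. pword (Suc c) f (Suc (Suc c)) \<and> length f = n1 \<and>
          subst (Suc c) [c] f = z \<and> (\<forall>x<c. \<chi>1 (subst (Suc c) [x] f) = \<kappa>)"
        unfolding focused_lines_def by blast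
      let ?z = "z @ l" and ?Q = "insert (\<chi>1 z) Q"
      have z': "pword (Suc c) ?z (Suc c)" "length ?z = n1 + n2"
        using z l l_less by (auto simp: pword_append pword_const_iff le_imp_less_Suc)
      have lines': "\<exists>f. pword (Suc c) f (Suc (Suc c)) \<and> length f = n1 + n2 \<and>
          subst (Suc c) [c] f = ?z \<and> (\<forall>x<c. \<chi> (subst (Suc c) [x] f) = \<kappa>)" if "\<kappa> \<in> ?Q" for \<kappa>
      proof (cases "\<kappa> \<in> Q")
        case True
        then obtain f where f: "pword (Suc c) f (Suc (Suc c))" "length f = n1"
          "subst (Suc c) [c] f = z" "\<And>x. x < c \<Longrightarrow> \<chi>1 (subst (Suc c) [x] f) = \<kappa>"
          using lines by blast
        have "subst (Suc c) [x] f \<in> ?U" if "x < c" for x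
          using that f(1,2) pword_subst[of "Suc c" f "[x]" "Suc c"] by simp
        then show ?thesis
          using f l' sub_l' sub_l'_c col1
          by (intro exI[of _ "f @ l'"]) (auto simp: pword_append)
      next
        case False
        then have "\<kappa> = \<chi>1 z" using that by blast
        moreover have "subst (Suc c) g z = z" for g
          using z(1) by (intro subst_const) (auto simp: pword_const_iff)
        ultimately show ?thesis
          using z l'(2) l'_line sub_l' sub_l'_c col1
          by (intro exI[of _ "z @ l'"]) (auto simp: pword_append)
      qed
      have "\<chi> ?z \<notin> ?Q"
      proof
        assume "\<chi> ?z \<in> ?Q"
        from lines'[OF this] have "monochromatic_line c (n1 + n2) \<chi>"
          unfolding monochromatic_line_def by (metis le_neq_implies_less)
        with False show False by blast
      qed
      moreover have "?Q \<subseteq> S" using Q(1) \<open>?col n1 \<chi>1\<close> z by blast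
      moreover have "card ?Q = Suc q"
        using Q finite_subset[OF Q(1) assms(3)] by simp
      ultimately have "focused_lines c (n1 + n2) (Suc q) S \<chi>"
        unfolding focused_lines_def using z' lines' by blast
      then show ?thesis by blast
    qed
  qed blast
  then show ?case by blast
qed

text \<open>
  Induction on the alphabet. As many focused lines as there are colours leave no colour for the
  focus, so a monochromatic line must exist.
\<close>

lemma hales_jewett_line:
  assumes "finite S" "S \<noteq> {}"
  shows "\<exists>n. monochromatic_subspace c c 1 S n"
  using assms
proof (induction c arbitrary: S)
  case 0
  have "\<not> (pword 0 g 0 \<and> length g = 1)" for g :: "nat list"
    by (cases g) auto
  then have "monochromatic_subspace 0 0 1 S 1"
    unfolding monochromatic_subspace_def by (intro allI impI exI[of _ "[0]"]) auto
  then show ?case by blast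
next
  case (Suc c)
  show ?case
  proof (cases "c = 0")
    \<comment> \<open>Over one letter a line is a single point; focusing needs a point before the last one.\<close>
    case True
    have "g = [0]" if "pword 1 g 1 \<and> length g = 1" for g
      using that by (cases g) auto
    then have "monochromatic_subspace 1 1 1 S 1"
      unfolding monochromatic_subspace_def
      by (intro allI impI exI[of _ "[1]"]) (auto intro!: exI)
    then show ?thesis using True by auto
  next
    case False
    then obtain n where n: "\<forall>\<chi>. (\<forall>w. pword (Suc c) w (Suc c) \<and> length w = n \<longrightarrow> \<chi> w \<in> S) \<longrightarrow>
      monochromatic_line c n \<chi> \<or> focused_lines c n (card S) S \<chi>"
      using monochromatic_or_focused_lines[OF Suc.IH _ Suc.prems, of "card S"] by auto
    have "\<exists>f \<kappa>. pword (Suc c) f (Suc c + 1) \<and> length f = n \<and>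
         (\<forall>g. pword (Suc c) g (Suc c) \<and> length g = 1 \<longrightarrow> \<chi> (subst (Suc c) g f) = \<kappa>)"
      if col: "\<forall>w. pword (Suc c) w (Suc c) \<and> length w = n \<longrightarrow> \<chi> w \<in> S" for \<chi>
    proof -
      have "Q = S" if "Q \<subseteq> S" "card Q = card S" for Q
        using that card_subset_eq Suc.prems(1) by blast
      then have "\<not> focused_lines c n (card S) S \<chi>"
        unfolding focused_lines_def using col by blast
      then obtain f \<kappa> where "pword (Suc c) f (Suc (Suc c))" "length f = n"
        "\<forall>x\<le>c. \<chi> (subst (Suc c) [x] f) = \<kappa>"
        using n col unfolding monochromatic_line_def by blast
      moreover have "\<exists>x\<le>c. g = [x]" if "pword (Suc c) g (Suc c)" "length g = 1" for g
        using that by (auto simp: length_Suc_conv pword_const_iff)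
      ultimately show ?thesis by (metis add.commute plus_1_eq_Suc)
    qed
    then show ?thesis unfolding monochromatic_subspace_def by blast
  qed
qed

lemma pword_upt: "pword c [c..<c + m] (c + m)"
  by (induction m) (auto simp: pword_append)

text \<open>
  Product argument: first choose an \<open>m\<close>-dimensional subspace of the first factor along which the
  colouring of the second factor does not change, then a monochromatic line in the second.
\<close>

theorem hales_jewett:
  assumes "finite S" "S \<noteq> {}"
  shows "\<exists>n. monochromatic_subspace c c m S n"
proof (cases "c = 0")
  case True
  have "\<not> (pword 0 g 0 \<and> length g = m)" if "m \<noteq> 0" for g :: "nat list"
    using that by (cases g) (auto dest: pword_le)
  then have "monochromatic_subspace 0 0 m S m"
    using pword_upt[of 0 m] unfolding monochromatic_subspace_def
    by (cases "m = 0") (auto intro!: exI[of _ "[0..<m]"])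
  with True show ?thesis by blast
next
  case False
  then have "0 < c" by simp
  show ?thesis using assms
  proof (induction m arbitrary: S)
    case 0
    have "monochromatic_subspace c c 0 S 0"
      unfolding monochromatic_subspace_def by (intro allI impI exI[of _ "[]"]) auto
    then show ?case by blast
  next
    case (Suc m)
    obtain n2 where n2: "monochromatic_subspace c c 1 S n2" using hales_jewett_line Suc.prems by blast
    let ?V = "{v. pword c v c \<and> length v = n2}"
    obtain L where L: "set L = ?V" using finite_list[OF finite_constant_words[of c n2]] by blast
    define enc where "enc = pack L"
    define dec where "dec = unpack L"
    obtain S' where S': "finite S'" "S' \<noteq> {}"
      and enc: "\<forall>\<phi>. \<phi> ` ?V \<subseteq> S \<longrightarrow> enc \<phi> \<in> S'"
      unfolding enc_def by (rule packed_colours[OF Suc.prems, of L, unfolded L])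
    have dec: "dec (enc \<phi>) v = \<phi> v" if "v \<in> ?V" for \<phi> v
      unfolding enc_def dec_def using that L unpack_pack[of v L \<phi>] by simp
    obtain n1 where n1: "monochromatic_subspace c c m S' n1" using Suc.IH S' by blast
    have "\<exists>f \<kappa>. pword c f (c + Suc m) \<and> length f = n1 + n2 \<and>
           (\<forall>g. pword c g c \<and> length g = Suc m \<longrightarrow> \<chi> (subst c g f) = \<kappa>)"
      if col: "\<forall>w. pword c w c \<and> length w = n1 + n2 \<longrightarrow> \<chi> w \<in> S" for \<chi>
    proof -
      have *: "enc (\<lambda>v. \<chi> (u @ v)) \<in> S'" if "pword c u c" "length u = n1" for u
        using that by (intro enc[rule_format] image_subsetI col[rule_format]) (auto simp: pword_append)
      obtain f1 \<kappa>1 where f1: "pword c f1 (c + m)" "length f1 = n1"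
        and \<kappa>1: "\<forall>g. pword c g c \<and> length g = m \<longrightarrow> enc (\<lambda>v. \<chi> (subst c g f1 @ v)) = \<kappa>1"
        by (rule monochromatic_subspaceE[OF n1, of "\<lambda>u. enc (\<lambda>v. \<chi> (u @ v))", OF *])
      let ?o = "replicate m 0"
      have o: "pword c ?o c" using \<open>0 < c\<close> by (auto simp: pword_const_iff)
      define \<chi>2 where "\<chi>2 v = \<chi> (subst c ?o f1 @ v)" for v
      have const1: "pword c (subst c g f1) c" if "pword c g c" "length g = m" for g
        using pword_subst f1(1) that by blast
      have "\<chi>2 v \<in> S" if "pword c v c" "length v = n2" for v
        unfolding \<chi>2_def using that const1[OF o] f1(2)
        by (intro col[rule_format]) (auto simp: pword_append)
      then obtain f2 \<kappa>2 where f2: "pword c f2 (c + 1)" "length f2 = n2"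
        and \<kappa>2: "\<forall>g. pword c g c \<and> length g = 1 \<longrightarrow> \<chi>2 (subst c g f2) = \<kappa>2"
        by (rule monochromatic_subspaceE[OF n2])
      have col2: "\<chi> (subst c g f1 @ v) = \<chi>2 v"
        if "pword c g c" "length g = m" "v \<in> ?V" for g v
      proof -
        have "enc (\<lambda>v. \<chi> (subst c g f1 @ v)) = enc (\<lambda>v. \<chi> (subst c ?o f1 @ v))"
          using \<kappa>1 that o by simp
        from dec[OF that(3), of "\<lambda>v. \<chi> (subst c g f1 @ v)", unfolded this] dec[OF that(3)]
        show ?thesis by (simp add: \<chi>2_def)
      qed
      define f2' where "f2' = subst c [c + m] f2"
      have f2': "pword (c + m) f2' (c + Suc m)"
      proof -
        obtain a b where ab: "f2 = a @ c # b" "pword c a c" "pword (Suc c) b (Suc c)"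
          by (rule pword_split[OF f2(1), of c]) auto
        have "f2' = a @ (c + m) # subst c [c + m] b"
          using ab subst_const by (auto simp: f2'_def subst_Cons pword_const_iff)
        moreover have "pword (c + Suc m) (subst c [c + m] b) (c + Suc m)"
          using ab(3) by (fastforce simp: pword_const_iff subst_def)
        moreover have "pword (c + m) a (c + m)" using ab(2) by (rule pword_mono_const) simp
        ultimately show ?thesis by (auto simp: pword_append)
      qed
      have "\<chi> (subst c g (f1 @ f2')) = \<kappa>2" if g: "pword c g c" "length g = Suc m" for g
      proof -
        obtain g1 x where gx: "g = g1 @ [x]" "length g1 = m"
          using g(2) by (metis length_Suc_conv_rev)
        then have g1: "pword c g1 c" "pword c [x] c" using g(1) by (auto simp: pword_const_iff)
        have "subst c g f1 = subst c g1 f1"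
          using gx pword_letter_less[OF f1(1)] subst_prefix by simp
        moreover have "subst c g f2' = subst c [x] f2"
          using gx pword_letter_less[OF f2(1)] by (fastforce simp: f2'_def subst_def nth_append)
        moreover have "subst c [x] f2 \<in> ?V"
          using f2 g1 pword_subst[of c f2 "[x]" c] by simp
        ultimately show ?thesis using col2[OF g1(1) gx(2)] \<kappa>2 g1(2) by simp
      qed
      moreover have "pword c (f1 @ f2') (c + Suc m)" using f1(1) f2' by (auto simp: pword_append)
      moreover have "length (f1 @ f2') = n1 + n2" using f1(2) f2(2) by (simp add: f2'_def)
      ultimately show ?thesis by blast
    qed
    then show ?case unfolding monochromatic_subspace_def by blast
  qed
qed

section \<open>The Graham-Rothschild theorem\<close>

text \<open>
  A word with at least one parameter is \<open>h @ c # g\<close>, where \<open>h\<close> is over \<open>{..<c}\<close> and \<open>g\<close> has one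
  parameter fewer over an alphabet with one letter more. Hence the assumption \<open>R\<close> can make the
  colour independent of \<open>g\<close>: the tail \<open>t\<close> below does this for the words that start with \<open>c\<close>. For
  the words that start with a constant \<open>x\<close>, the remaining letters are treated by induction, for
  all \<open>x < c\<close> at the same time; the substitution \<open>c # f2'\<close> keeps the first parameter of \<open>c # t\<close>
  as it is, and so preserves what was achieved by \<open>t\<close>.
\<close>

lemma depends_on_prefix:
  fixes S :: "nat set"
  assumes R: "\<And>S m. finite S \<Longrightarrow> S \<noteq> {} \<Longrightarrow> \<exists>n. monochromatic_subspace (Suc c) d m S n"
    and "c < d" "finite S" "S \<noteq> {}"
  shows "\<exists>n. \<forall>\<chi>. (\<forall>w. pword c w d \<and> length w = n \<longrightarrow> \<chi> w \<in> S) \<longrightarrow>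
    (\<exists>f \<psi>. pword c f (c + m) \<and> length f = n \<and>
      (\<forall>w. pword c w d \<and> length w = m \<longrightarrow> \<chi> (subst c w f) = \<psi> (takeWhile (\<lambda>x. x < c) w)))"
  using assms(3,4)
proof (induction m arbitrary: S)
  case 0
  show ?case using \<open>c < d\<close> by (intro exI[of _ 0] allI impI exI[of _ "[]"]) auto
next
  case (Suc m)
  obtain L where L: "set L = {..<c}" using finite_list[OF finite_lessThan[of c]] by blast
  define enc where "enc = pack L"
  define dec where "dec = unpack L"
  obtain S' where S': "finite S'" "S' \<noteq> {}"
    and enc: "\<forall>\<phi>. \<phi> ` {..<c} \<subseteq> S \<longrightarrow> enc \<phi> \<in> S'"
    unfolding enc_def by (rule packed_colours[OF Suc.prems, of L, unfolded L])
  have dec: "dec (enc \<phi>) x = \<phi> x" if "x \<in> {..<c}" for \<phi> x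
    unfolding enc_def dec_def using that L unpack_pack[of x L \<phi>] by simp
  obtain k where k: "\<And>\<chi>. \<forall>w. pword c w d \<and> length w = k \<longrightarrow> \<chi> w \<in> S' \<Longrightarrow>
    \<exists>f \<psi>. pword c f (c + m) \<and> length f = k \<and>
      (\<forall>w. pword c w d \<and> length w = m \<longrightarrow> \<chi> (subst c w f) = \<psi> (takeWhile (\<lambda>x. x < c) w))"
    using Suc.IH[OF S'] by blast
  obtain n where n: "monochromatic_subspace (Suc c) d k S n" using R Suc.prems by blast
  have "\<exists>f \<psi>. pword c f (c + Suc m) \<and> length f = Suc n \<and>
      (\<forall>w. pword c w d \<and> length w = Suc m \<longrightarrow> \<chi> (subst c w f) = \<psi> (takeWhile (\<lambda>x. x < c) w))"
    if col: "\<forall>w. pword c w d \<and> length w = Suc n \<longrightarrow> \<chi> w \<in> S" for \<chi>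
  proof -
    obtain t \<kappa> where t: "pword (Suc c) t (Suc c + k)" "length t = n"
      and \<kappa>: "\<forall>g. pword (Suc c) g d \<and> length g = k \<longrightarrow> \<chi> (c # subst (Suc c) g t) = \<kappa>"
      by (rule monochromatic_subspaceE[OF n, of "\<lambda>g. \<chi> (c # g)"]) (use col in auto)
    let ?f1 = "c # t"
    have f1: "pword c ?f1 (c + Suc k)" using t(1) by simp
    have "\<chi> (subst c (x # w) ?f1) \<in> S" if "pword c w d" "length w = k" "x < c" for x w
      using that f1 t(2) pword_subst[of c ?f1 "x # w" d] by (intro col[rule_format]) simp
    then have "enc (\<lambda>x. \<chi> (subst c (x # w) ?f1)) \<in> S'" if "pword c w d" "length w = k" for w
      using that by (intro enc[rule_format] image_subsetI) simp
    then obtain f2 \<psi>2 where f2: "pword c f2 (c + m)" "length f2 = k"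
      and \<psi>2: "\<And>w. pword c w d \<Longrightarrow> length w = m \<Longrightarrow>
        enc (\<lambda>x. \<chi> (subst c (x # subst c w f2) ?f1)) = \<psi>2 (takeWhile (\<lambda>x. x < c) w)"
      using k[of "\<lambda>w. enc (\<lambda>x. \<chi> (subst c (x # w) ?f1))"] by blast
    define f2' where "f2' = skip_letter c f2"
    have f2': "pword (Suc c) f2' (Suc c + m)" "length f2' = k"
      using pword_skip_letter[OF f2(1) order_refl] f2(2) by (auto simp: f2'_def skip_letter_def)
    define f where "f = subst c (c # f2') ?f1"
    have f_pword: "pword c f (c + Suc m)"
      unfolding f_def using f1 f2' by (intro pword_subst) auto
    have subst_f: "subst c w f = subst c (subst c w (c # f2')) ?f1" for w
      unfolding f_def using pword_letter_less[OF f1] f2' by (intro subst_subst) auto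
    define \<psi> where "\<psi> h = (case h of [] \<Rightarrow> \<kappa> | x # h' \<Rightarrow> dec (\<psi>2 h') x)" for h
    have "\<chi> (subst c w f) = \<psi> (takeWhile (\<lambda>x. x < c) w)"
      if w: "pword c w d" "length w = Suc m" for w
    proof -
      obtain y w' where w': "w = y # w'" "length w' = m" using w(2) by (auto simp: length_Suc_conv)
      show ?thesis
      proof (cases "y < c")
        case True
        then have "pword c w' d" using w(1) w'(1) by simp
        moreover have "subst c w (c # f2') = y # subst c w' f2"
          using w' by (auto simp: subst_def f2'_def skip_letter_def Suc_diff_le)
        ultimately show ?thesis
          using w' True dec[of y "\<lambda>x. \<chi> (subst c (x # subst c w' f2) ?f1)"] \<psi>2[of w']
          by (simp add: \<psi>_def subst_f)
      next
        case False
        then have y: "y = c" "pword (Suc c) w' d" using w(1) w'(1) by auto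
        let ?g = "subst (Suc c) w' f2'"
        have "subst c w (c # f2') = c # ?g"
          using w'(1) y(1) by (simp add: subst_Cons subst_parameter_as_letter)
        then have "subst c w f = c # subst (Suc c) ?g t"
          by (simp add: subst_f subst_Cons subst_parameter_as_letter)
        moreover have "pword (Suc c) ?g d"
          using f2'(1) y(2) w'(2) by (intro pword_subst) auto
        ultimately show ?thesis using \<kappa>[rule_format, of ?g] f2'(2) w' y(1) by (simp add: \<psi>_def)
      qed
    qed
    then show ?thesis using f_pword t(2) by (intro exI[of _ f] exI[of _ \<psi>]) (auto simp: f_def)
  qed
  then show ?case by blast
qed

text \<open>
  The Hales-Jewett theorem then removes the dependence on the letters of the prefix. The longest
  prefixes come first: a subspace \<open>w\<close> on which \<open>\<psi>\<close> has the constant value \<open>\<kappa>0\<close>, followed by a last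
  parameter, takes care of the prefixes of length \<open>m\<close>. Shorter prefixes are treated within \<open>w\<close>
  by induction, with the colouring \<open>\<psi>'\<close>. It colours a prefix \<open>h\<close> by way of an arbitrary word of
  length \<open>k\<close> that begins with \<open>h\<close> and continues with \<open>c\<close>; by \<open>subst_first_parameter\<close> the choice
  is immaterial, and repeating the letter \<open>c\<close> is the simplest one.
\<close>

lemma depends_on_prefix_length:
  fixes S :: "nat set"
  assumes "finite S" "S \<noteq> {}"
  shows "\<exists>n. \<forall>\<psi>. (\<forall>h. \<psi> h \<in> S) \<longrightarrow>
    (\<exists>f \<kappa>. pword c f (c + m) \<and> length f = n \<and>
      (\<forall>h g. set h \<subseteq> {..<c} \<and> length h + Suc (length g) = m \<longrightarrow>
        \<psi> (takeWhile (\<lambda>x. x < c) (subst c (h @ c # g) f)) = \<kappa> (length h)))"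
proof (induction m)
  case 0
  show ?case by (intro exI[of _ 0] allI impI exI[of _ "[]"]) auto
next
  case (Suc m)
  then obtain k where k: "\<And>\<psi>. (\<And>h. \<psi> h \<in> S) \<Longrightarrow>
    \<exists>f \<kappa>. pword c f (c + m) \<and> length f = k \<and>
      (\<forall>h g. set h \<subseteq> {..<c} \<and> length h + Suc (length g) = m \<longrightarrow>
        \<psi> (takeWhile (\<lambda>x. x < c) (subst c (h @ c # g) f)) = \<kappa> (length h))" by blast
  obtain l where l: "monochromatic_subspace c c k S l" using hales_jewett assms by blast
  have "\<exists>f \<kappa>. pword c f (c + Suc m) \<and> length f = Suc l \<and>
      (\<forall>h g. set h \<subseteq> {..<c} \<and> length h + Suc (length g) = Suc m \<longrightarrow>
        \<psi> (takeWhile (\<lambda>x. x < c) (subst c (h @ c # g) f)) = \<kappa> (length h))"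
    if \<psi>: "\<And>h. \<psi> h \<in> S" for \<psi>
  proof -
    let ?pre = "takeWhile (\<lambda>x. x < c)"
    obtain w \<kappa>0 where w: "pword c w (c + k)" "length w = l"
      and \<kappa>0: "\<forall>h. pword c h c \<and> length h = k \<longrightarrow> \<psi> (subst c h w) = \<kappa>0"
      by (rule monochromatic_subspaceE[OF l, of \<psi>, OF \<psi>])
    define \<psi>' where "\<psi>' h = \<psi> (?pre (subst c (h @ replicate (k - length h) c) w))" for h
    obtain f' \<kappa>' where f': "pword c f' (c + m)" "length f' = k"
      and \<kappa>': "\<And>h g. set h \<subseteq> {..<c} \<Longrightarrow> length h + Suc (length g) = m \<Longrightarrow>
        \<psi>' (?pre (subst c (h @ c # g) f')) = \<kappa>' (length h)"
      using k[of \<psi>'] \<psi> unfolding \<psi>'_def by blast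
    define f where "f = subst c f' w @ [c + m]"
    have wf': "pword c (subst c f' w) (c + m)"
      using w(1) f' by (intro pword_subst) auto
    have w_f': "subst c v (subst c f' w) = subst c (subst c v f') w" for v
      using pword_letter_less[OF w(1)] f'(2) by (intro subst_subst) auto
    have "\<psi> (?pre (subst c (h @ c # g) f)) = (\<kappa>'(m := \<kappa>0)) (length h)"
      if hg: "set h \<subseteq> {..<c}" "length h + Suc (length g) = Suc m" for h g
    proof (cases g rule: rev_cases)
      case Nil
      then have h: "length h = m" using hg(2) by simp
      have const: "pword c (subst c h f') c"
        using f'(1) h hg(1) by (intro pword_subst) (auto simp: pword_const_iff)
      have "subst c (h @ [c]) (subst c f' w) = subst c h (subst c f' w)"
        using pword_letter_less[OF wf'] h by (intro subst_prefix) auto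
      then have "subst c (h @ c # g) f = subst c (subst c h f') w @ [c]"
        using Nil h by (simp add: f_def w_f' subst_Cons nth_append)
      moreover have "set (subst c (subst c h f') w) \<subseteq> {..<c}"
        using pword_subst[OF _ const, of w] w(1) f'(2) by (simp add: pword_const_iff)
      ultimately have "?pre (subst c (h @ c # g) f) = subst c (subst c h f') w"
        using takeWhile_first_parameter by simp
      then show ?thesis using \<kappa>0 const f'(2) h by simp
    next
      case (snoc g0 x)
      then have len: "length h + Suc (length g0) = m" using hg(2) by simp
      obtain h' where h': "set h' \<subseteq> {..<c}"
        and ex_g': "\<And>g. length h + Suc (length g) = m \<Longrightarrow> \<exists>g'. subst c (h @ c # g) f' = h' @ c # g'"
        using subst_first_parameter[OF f'(1) hg(1)] len by (metis less_add_Suc1 add_Suc_right)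
      obtain g' where g': "subst c (h @ c # g0) f' = h' @ c # g'" using ex_g'[OF len] by blast
      then have len': "length h' + Suc (length g') = k" using f'(2) by (metis length_subst length_append length_Cons)
      then obtain h'' where h'': "set h'' \<subseteq> {..<c}"
        and ex_g'': "\<And>g. length h' + Suc (length g) = k \<Longrightarrow> \<exists>g'. subst c (h' @ c # g) w = h'' @ c # g'"
        using subst_first_parameter[OF w(1) h'] by (metis less_add_Suc1 add_Suc_right)
      have pre: "?pre (subst c (h' @ c # g) w) = h''" if "length h' + Suc (length g) = k" for g
        using ex_g''[OF that] h'' takeWhile_first_parameter by metis
      have "replicate (k - length h') c = c # replicate (length g') c"
        using len' by (metis add_diff_cancel_left' replicate_Suc)
      then have "\<psi>' h' = \<psi> h''" using pre[of "replicate (length g') c"] len' by (simp add: \<psi>'_def)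
      moreover have "\<psi>' h' = \<kappa>' (length h)"
        using \<kappa>'[OF hg(1) len] g' takeWhile_first_parameter[OF h'] by simp
      moreover have "?pre (subst c (h @ c # g) f) = h''"
      proof -
        have "subst c ((h @ c # g0) @ [x]) (subst c f' w) = subst c (h @ c # g0) (subst c f' w)"
          using pword_letter_less[OF wf'] len by (intro subst_prefix) auto
        then have "subst c (h @ c # g) (subst c f' w) = subst c (h' @ c # g') w"
          using snoc g' by (simp add: w_f')
        then obtain g'' where "subst c (h @ c # g) f = h'' @ c # g''"
          using ex_g''[OF len'] by (auto simp: f_def)
        then show ?thesis using takeWhile_first_parameter[OF h''] by simp
      qed
      ultimately show ?thesis using len by simp
    qed
    moreover have "pword c f (c + Suc m)" using wf' by (auto simp: f_def pword_append)
    moreover have "length f = Suc l" by (simp add: f_def w(2))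
    ultimately show ?thesis by blast
  qed
  then show ?case by blast
qed

text \<open>
  Making all parameters with numbers outside \<open>J\<close> constant (equal to the letter \<open>0\<close>, whence
  \<open>0 < c\<close>) leaves only words whose first letter \<open>c\<close> is at a position in \<open>J\<close>.
\<close>

lemma select_parameters:
  fixes c :: nat
  assumes "0 < c" "J \<subseteq> {..<M}"
  shows "\<exists>p. pword c p (c + card J) \<and> length p = M \<and>
    (\<forall>h g. set h \<subseteq> {..<c} \<and> length h + Suc (length g) = card J \<longrightarrow>
       length (takeWhile (\<lambda>x. x < c) (subst c (h @ c # g) p)) \<in> J)"
  using assms(2)
proof (induction M arbitrary: J)
  case 0
  then show ?case by (auto intro!: exI[of _ "[]"])
next
  case (Suc M)
  let ?pre = "takeWhile (\<lambda>x. x < c)"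
  have "J - {M} \<subseteq> {..<M}" using Suc.prems by (auto simp: less_Suc_eq)
  from Suc.IH[OF this] obtain p where p: "pword c p (c + card (J - {M}))" "length p = M"
    and pJ: "\<And>h g. set h \<subseteq> {..<c} \<Longrightarrow> length h + Suc (length g) = card (J - {M}) \<Longrightarrow>
       length (?pre (subst c (h @ c # g) p)) \<in> J - {M}"
    by blast
  have pre: "?pre (subst c (h @ c # g @ g') p @ v) = ?pre (subst c (h @ c # g) p)"
    if hg: "set h \<subseteq> {..<c}" "length h + Suc (length g) = card (J - {M})" for h g g' v
  proof -
    have eq: "subst c (h @ c # g @ g') p = subst c (h @ c # g) p"
      using subst_prefix[of p c "h @ c # g" g'] pword_letter_less[OF p(1)] hg(2) by fastforce
    obtain h' g'' where "set h' \<subseteq> {..<c}" "subst c (h @ c # g) p = h' @ c # g''"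
      using subst_first_parameter[OF p(1) hg(1)] hg(2) by (metis less_add_Suc1 add_Suc_right)
    then show ?thesis using takeWhile_first_parameter eq by simp
  qed
  show ?case
  proof (cases "M \<in> J")
    case False
    then have "J - {M} = J" by simp
    then show ?thesis using p pJ pre[of _ _ "[]"] \<open>0 < c\<close>
      by (intro exI[of _ "p @ [0]"]) (auto simp: pword_append subst_Cons)
  next
    case True
    then have card: "card J = Suc (card (J - {M}))"
      using card.remove[OF finite_subset[OF Suc.prems] True] by simp
    have "length (?pre (subst c (h @ c # g) (p @ [c + card (J - {M})]))) \<in> J"
      if hg: "set h \<subseteq> {..<c}" "length h + Suc (length g) = card J" for h g
    proof (cases g rule: rev_cases)
      case Nil
      then have h: "length h = card (J - {M})" using hg(2) card by simp
      have "subst c (h @ [c]) p = subst c h p"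
        using pword_letter_less[OF p(1)] h by (intro subst_prefix) auto
      moreover have "set (subst c h p) \<subseteq> {..<c}"
        using pword_subst[of c p h c] p(1) h hg(1) by (simp add: pword_const_iff)
      ultimately have "?pre (subst c (h @ c # g) (p @ [c + card (J - {M})])) = subst c h p"
        using Nil h takeWhile_first_parameter by (simp add: subst_Cons nth_append)
      then show ?thesis using p(2) True by simp
    next
      case (snoc g0 x)
      then show ?thesis using pJ[OF hg(1), of g0] pre[OF hg(1), of g0 "[x]"] hg(2) card by simp
    qed
    then show ?thesis using p card
      by (intro exI[of _ "p @ [c + card (J - {M})]"]) (auto simp: pword_append)
  qed
qed

lemma pigeonhole_colour_class:
  assumes "finite S" "S \<noteq> {}" "\<And>i. i < card S * m \<Longrightarrow> \<kappa> i \<in> S"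
  obtains J s where "J \<subseteq> {..<card S * m}" "card J = m" "\<And>i. i \<in> J \<Longrightarrow> \<kappa> i = s"
proof -
  let ?I = "{..<card S * m}"
  have "\<exists>s\<in>S. m \<le> card {i \<in> ?I. \<kappa> i = s}"
  proof (rule ccontr)
    assume "\<not> ?thesis"
    then have "(\<Sum>s\<in>S. card {i \<in> ?I. \<kappa> i = s}) < (\<Sum>s\<in>S. m)"
      using assms(1,2) by (intro sum_strict_mono) (auto simp: not_le)
    moreover have "(\<Sum>s\<in>S. card {i \<in> ?I. \<kappa> i = s}) = card ?I"
    proof -
      have "card (\<Union>s\<in>S. {i \<in> ?I. \<kappa> i = s}) = (\<Sum>s\<in>S. card {i \<in> ?I. \<kappa> i = s})"
        using assms(1) by (intro card_UN_disjoint) auto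
      moreover have "(\<Union>s\<in>S. {i \<in> ?I. \<kappa> i = s}) = ?I" using assms(3) by auto
      ultimately show ?thesis by simp
    qed
    ultimately show False by simp
  qed
  then obtain s where "m \<le> card {i \<in> ?I. \<kappa> i = s}" by blast
  then obtain J where "J \<subseteq> {i \<in> ?I. \<kappa> i = s}" "card J = m"
    using obtain_subset_with_card_n by metis
  then show ?thesis using that[of J s] by blast
qed

text \<open>
  Induction on the number \<open>d - c\<close> of parameters, over all alphabets at once. After the colour has
  been made to depend on the length of the constant prefix only, the pigeonhole principle gives a set \<open>J\<close>
  of \<open>m\<close> lengths of the same colour, and \<open>select_parameters\<close> restricts to them. Without any
  constants (\<open>c = 0\<close>) the prefix is empty and \<open>depends_on_prefix\<close> suffices.
\<close>

theorem graham_rothschild: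
  assumes "finite S" "S \<noteq> {}" "c \<le> d"
  shows "\<exists>n. monochromatic_subspace c d m S n"
  using assms
proof (induction "d - c" arbitrary: c m S)
  case 0
  then show ?case using hales_jewett by simp
next
  case (Suc k)
  then have "c < d" by simp
  let ?pre = "takeWhile (\<lambda>x. x < c)"
  have step: "\<exists>n. monochromatic_subspace (Suc c) d m S n" if "finite S" "S \<noteq> {}" for S m
    using Suc.hyps(2) by (intro Suc.hyps(1) that) auto
  note prefix = depends_on_prefix[OF step \<open>c < d\<close> Suc.prems(1,2)]
  show ?case
  proof (cases "c = 0")
    case True
    then have empty: "takeWhile (\<lambda>x. x < c) w = []" for w by (simp add: takeWhile_eq_Nil_iff)
    show ?thesis using prefix[of m] unfolding monochromatic_subspace_def empty by metis
  next
    case False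
    define M where "M = card S * m"
    obtain n2 where n2: "\<And>\<psi>. (\<And>h. \<psi> h \<in> S) \<Longrightarrow>
      (\<exists>f \<kappa>. pword c f (c + M) \<and> length f = n2 \<and>
        (\<forall>h g. set h \<subseteq> {..<c} \<and> length h + Suc (length g) = M \<longrightarrow>
          \<psi> (?pre (subst c (h @ c # g) f)) = \<kappa> (length h)))"
      using depends_on_prefix_length[OF Suc.prems(1,2), of c M] by blast
    obtain n where n: "\<And>\<chi>. (\<forall>w. pword c w d \<and> length w = n \<longrightarrow> \<chi> w \<in> S) \<Longrightarrow>
      (\<exists>f \<psi>. pword c f (c + n2) \<and> length f = n \<and>
        (\<forall>w. pword c w d \<and> length w = n2 \<longrightarrow> \<chi> (subst c w f) = \<psi> (?pre w)))"
      using prefix[of n2] by blast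
    obtain s0 where s0: "s0 \<in> S" using Suc.prems(2) by blast
    have "\<exists>f \<kappa>. pword c f (c + m) \<and> length f = n \<and>
         (\<forall>g. pword c g d \<and> length g = m \<longrightarrow> \<chi> (subst c g f) = \<kappa>)"
      if col: "\<forall>w. pword c w d \<and> length w = n \<longrightarrow> \<chi> w \<in> S" for \<chi>
    proof -
      obtain f1 \<psi> where f1: "pword c f1 (c + n2)" "length f1 = n"
        and \<psi>: "\<And>w. pword c w d \<Longrightarrow> length w = n2 \<Longrightarrow> \<chi> (subst c w f1) = \<psi> (?pre w)"
        using n[OF col] by blast
      \<comment> \<open>On prefixes that do not come from a word the value of \<open>\<psi>\<close> is arbitrary, possibly outside \<open>S\<close>.\<close>
      define \<psi>' where "\<psi>' h = (if \<psi> h \<in> S then \<psi> h else s0)" for h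
      obtain f2 \<kappa> where f2: "pword c f2 (c + M)" "length f2 = n2"
        and \<kappa>: "\<And>h g. set h \<subseteq> {..<c} \<Longrightarrow> length h + Suc (length g) = M \<Longrightarrow>
          \<psi>' (?pre (subst c (h @ c # g) f2)) = \<kappa> (length h)"
        using n2[of \<psi>'] s0 unfolding \<psi>'_def by (metis (full_types))
      have \<kappa>_S: "\<kappa> i \<in> S" if "i < M" for i
      proof -
        have "\<psi>' (?pre (subst c (replicate i 0 @ c # replicate (M - Suc i) 0) f2)) = \<kappa> i"
          using \<kappa>[of "replicate i 0" "replicate (M - Suc i) 0"] that False
          by (simp add: set_replicate_conv_if)
        then show ?thesis using s0 unfolding \<psi>'_def by (metis (full_types))
      qed
      then obtain J s where J: "J \<subseteq> {..<M}" "card J = m" "\<And>i. i \<in> J \<Longrightarrow> \<kappa> i = s"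
        using pigeonhole_colour_class[OF Suc.prems(1,2)] unfolding M_def by metis
      obtain p where p: "pword c p (c + m)" "length p = M"
        and pJ: "\<And>h g. set h \<subseteq> {..<c} \<Longrightarrow> length h + Suc (length g) = m \<Longrightarrow>
          length (?pre (subst c (h @ c # g) p)) \<in> J"
        using select_parameters[OF _ J(1), of c] False J(2) by auto
      define f where "f = subst c (subst c p f2) f1"
      have pf2: "pword c (subst c p f2) (c + m)" using f2 p by (intro pword_subst) auto
      have "\<chi> (subst c g f) = s" if g: "pword c g d" "length g = m" for g
      proof -
        define v where "v = subst c g p"
        have v: "pword c v d" "length v = M"
          unfolding v_def using p g by (auto intro: pword_subst)
        have sub: "subst c g f = subst c (subst c v f2) f1"
          unfolding f_def v_def
          using pword_letter_less[OF f1(1)] pword_letter_less[OF f2(1)] p(2) f2(2)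
          by (subst subst_subst; simp add: subst_subst)
        have vf2: "pword c (subst c v f2) d" "length (subst c v f2) = n2"
          using f2 v by (auto intro: pword_subst)
        have "\<chi> (subst c g f) \<in> S"
          unfolding sub using f1 vf2 by (intro col[rule_format]) (auto intro: pword_subst)
        then have "\<chi> (subst c g f) = \<psi>' (?pre (subst c v f2))"
          using \<psi>[OF vf2] sub by (simp add: \<psi>'_def)
        also have "\<dots> = \<kappa> (length (?pre v))"
        proof -
          obtain h' g' where v': "v = h' @ c # g'" "set h' \<subseteq> {..<c}"
            using pword_first_parameter[OF v(1) \<open>c < d\<close>] by blast
          then show ?thesis using \<kappa>[of h' g'] v(2) takeWhile_first_parameter[OF v'(2)] by simp
        qed
        also have "length (?pre v) \<in> J"
        proof -
          obtain h' g' where g': "g = h' @ c # g'" "set h' \<subseteq> {..<c}"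
            using pword_first_parameter[OF g(1) \<open>c < d\<close>] by blast
          then show ?thesis using pJ[of h' g'] g(2) by (simp add: v_def)
        qed
        then have "\<kappa> (length (?pre v)) = s" by (rule J(3))
        finally show ?thesis .
      qed
      moreover have "pword c f (c + m)"
        unfolding f_def using f1 f2(2) pf2 by (simp add: pword_subst)
      ultimately show ?thesis using f1(2) by (intro exI[of _ f] exI[of _ s]) (auto simp: f_def)
    qed
    then show ?thesis unfolding monochromatic_subspace_def by blast
  qed
qed

section \<open>The lexicographic order of subsets\<close>

text \<open>
  Of two different sets, the larger one contains the \<open>r\<close>-least element of the symmetric difference.
  With this convention the order extends \<open>\<subset>\<close>.
\<close>

definition lex_order :: "('a \<times> 'a) set \<Rightarrow> 'a set \<Rightarrow> ('a set \<times> 'a set) set" where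
  "lex_order r V = {(X, Y). X \<subseteq> V \<and> Y \<subseteq> V \<and> (\<exists>z\<in>Y - X. \<forall>y. (y, z) \<in> r \<longrightarrow> (y \<in> X \<longleftrightarrow> y \<in> Y))}"

lemma lex_order_total:
  assumes "wf r" "X \<subseteq> V" "Y \<subseteq> V" "X \<noteq> Y"
  shows "(X, Y) \<in> lex_order r V \<or> (Y, X) \<in> lex_order r V"
proof -
  obtain a where "a \<in> (X - Y) \<union> (Y - X)" using assms(4) by blast
  from wfE_min[OF assms(1) this] obtain z where "z \<in> (X - Y) \<union> (Y - X)"
    "\<And>y. (y, z) \<in> r \<Longrightarrow> y \<notin> (X - Y) \<union> (Y - X)" by metis
  then show ?thesis unfolding lex_order_def using assms(2,3) by blast
qed

lemma trans_lex_order: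
  assumes "trans r" "total_on V r"
  shows "trans (lex_order r V)"
proof (rule transI)
  fix X Y Z assume XY: "(X, Y) \<in> lex_order r V" and YZ: "(Y, Z) \<in> lex_order r V"
  obtain a where a: "a \<in> Y - X" "\<And>y. (y, a) \<in> r \<Longrightarrow> y \<in> X \<longleftrightarrow> y \<in> Y"
    using XY by (auto simp: lex_order_def)
  obtain b where b: "b \<in> Z - Y" "\<And>y. (y, b) \<in> r \<Longrightarrow> y \<in> Y \<longleftrightarrow> y \<in> Z"
    using YZ by (auto simp: lex_order_def)
  have V: "X \<subseteq> V" "Y \<subseteq> V" "Z \<subseteq> V" using XY YZ by (auto simp: lex_order_def)
  have "(a, b) \<in> r \<or> (b, a) \<in> r"
    using a(1) b(1) V assms(2) unfolding total_on_def by (metis DiffD1 DiffD2 subsetD)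
  then show "(X, Z) \<in> lex_order r V"
  proof
    assume ab: "(a, b) \<in> r"
    then have "a \<in> Z - X" using a b by blast
    moreover have "y \<in> X \<longleftrightarrow> y \<in> Z" if "(y, a) \<in> r" for y
      using a(2)[OF that] b(2)[OF transD[OF assms(1) that ab]] by simp
    ultimately show ?thesis using V by (auto simp: lex_order_def)
  next
    assume ba: "(b, a) \<in> r"
    then have "b \<in> Z - X" using a b by blast
    moreover have "y \<in> X \<longleftrightarrow> y \<in> Z" if "(y, b) \<in> r" for y
      using b(2)[OF that] a(2)[OF transD[OF assms(1) that ba]] by simp
    ultimately show ?thesis using V by (auto simp: lex_order_def)
  qed
qed

lemma irrefl_lex_order: "irrefl (lex_order r V)"
  by (auto simp: irrefl_def lex_order_def)

lemma psubset_lex_order: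
  assumes "wf r" "X \<subset> Y" "Y \<subseteq> V"
  shows "(X, Y) \<in> lex_order r V"
  using lex_order_total[OF assms(1), of X V Y] assms(2,3) by (auto simp: lex_order_def)

lemma sorted_enumeration:
  assumes "finite X" "trans r" "irrefl r" "total_on X r"
  shows "\<exists>xs. set xs = X \<and> distinct xs \<and> sorted_wrt (\<lambda>x y. (x, y) \<in> r) xs"
  using assms(1,4)
proof (induction X rule: finite_induct)
  case (insert x X)
  then obtain xs where xs: "set xs = X" "distinct xs" "sorted_wrt (\<lambda>x y. (x, y) \<in> r) xs"
    by (auto simp: total_on_def)
  let ?ys = "filter (\<lambda>y. (y, x) \<in> r) xs @ x # filter (\<lambda>y. (x, y) \<in> r) xs"
  have "(y, x) \<in> r \<or> (x, y) \<in> r" if "y \<in> X" for y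
    using insert.hyps(2) insert.prems that by (auto simp: total_on_def)
  then have "set ?ys = insert x X" using xs(1) by auto
  moreover have "distinct ?ys"
    using xs(2) assms(2,3) by (auto simp: irrefl_def dest: transD)
  moreover have "sorted_wrt (\<lambda>x y. (x, y) \<in> r) ?ys"
    using xs(3) assms(2) by (auto simp: sorted_wrt_append sorted_wrt_filter dest: transD)
  ultimately show ?case by blast
qed simp

lemma sorted_index_less:
  assumes "sorted_wrt (\<lambda>x y. (x, y) \<in> r) xs" "trans r" "irrefl r"
    and "i < length xs" "j < length xs" "(xs ! i, xs ! j) \<in> r"
  shows "i < j"
proof (rule ccontr)
  assume "\<not> i < j"
  then consider "i = j" | "j < i" by linarith
  then show False
  proof cases
    case 1
    then show ?thesis using assms(3,6) by (auto simp: irrefl_def)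
  next
    case 2
    then have "(xs ! j, xs ! i) \<in> r" using assms(1,4) by (simp add: sorted_wrt_iff_nth_less)
    then have "(xs ! j, xs ! j) \<in> r" using transD[OF assms(2)] assms(6) by blast
    then show ?thesis using assms(3) by (auto simp: irrefl_def)
  qed
qed

section \<open>Linked upsets\<close>

text \<open>
  All five relations are determined by inclusion and disjointness, so embeddings need to respect
  only these two.
\<close>

lemma set_rel_cong:
  assumes "X \<subseteq> Y \<longleftrightarrow> X' \<subseteq> Y'" "Y \<subseteq> X \<longleftrightarrow> Y' \<subseteq> X'" "X \<inter> Y = {} \<longleftrightarrow> X' \<inter> Y' = {}"
  shows "set_rel t X Y \<longleftrightarrow> set_rel t X' Y'"
  using assms by (cases t) auto

lemma ordered_class_representation:
  assumes "A \<in> ordered_class"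
  obtains \<phi> where "\<forall>x\<in>carrier A. \<phi> x \<noteq> {}" "inj_on \<phi> (carrier A)"
    "\<forall>t. \<forall>x\<in>carrier A. \<forall>y\<in>carrier A. (x, y) \<in> rel A (Base t) \<longleftrightarrow> set_rel t (\<phi> x) (\<phi> y)"
proof -
  obtain \<phi> where "\<phi> \<in> embeddings (rcc5_reduct A) set_structure"
    using assms unfolding ordered_class_def age_def by blast
  then show ?thesis
    by (intro that[of \<phi>]) (auto simp: embeddings_def rcc5_reduct_def set_structure_def Pi_iff PiE_iff)
qed

lemma ordered_class_rel_carrier:
  "A \<in> ordered_class \<Longrightarrow> (x, y) \<in> rel A s \<Longrightarrow> x \<in> carrier A \<and> y \<in> carrier A"
  by (auto simp: ordered_class_def is_structure_def)

lemma ordered_class_order: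
  assumes "A \<in> ordered_class"
  shows "finite (carrier A)" "trans (rel A Prec)" "irrefl (rel A Prec)" "total_on (carrier A) (rel A Prec)"
    "rel A (Base PP) \<subseteq> rel A Prec" "wf (rel A Prec)"
proof -
  show fin: "finite (carrier A)" and tr: "trans (rel A Prec)" and irr: "irrefl (rel A Prec)"
    and "total_on (carrier A) (rel A Prec)" "rel A (Base PP) \<subseteq> rel A Prec"
    using assms by (auto simp: ordered_class_def strict_linear_order_on_def age_def rcc5_reduct_def)
  have "rel A Prec \<subseteq> carrier A \<times> carrier A"
    using assms by (auto simp: ordered_class_def is_structure_def)
  then have "finite (rel A Prec)" using fin by (meson finite_SigmaI finite_subset)
  moreover have "acyclic (rel A Prec)"
    using tr irr by (simp add: acyclic_irrefl)
  ultimately show "wf (rel A Prec)" by (rule finite_acyclic_wf)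
qed

text \<open>
  These are the traces that points leave: if the elements of \<open>A\<close> are nonempty sets of points, the
  elements that contain a given point form a linked upset. Conversely, sending \<open>x\<close> to the set of
  all linked upsets containing \<open>x\<close> represents \<open>A\<close> in the freest possible way.
\<close>

definition linked_upsets :: "(ordered_rcc5, 'a) bstruct \<Rightarrow> 'a set set" where
  "linked_upsets A = {F. F \<subseteq> carrier A \<and>
     (\<forall>x\<in>F. \<forall>y. (x, y) \<in> rel A (Base PP) \<longrightarrow> y \<in> F) \<and>
     (\<forall>x\<in>F. \<forall>y\<in>F. (x, y) \<notin> rel A (Base DR))}"

definition up_closure :: "(ordered_rcc5, 'a) bstruct \<Rightarrow> 'a set \<Rightarrow> 'a set" where
  "up_closure A G = G \<union> {y. \<exists>x\<in>G. (x, y) \<in> rel A (Base PP)}"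

lemma up_closure_linked_upset:
  assumes A: "A \<in> ordered_class" and G: "G \<subseteq> carrier A"
    and linked: "\<And>x y. x \<in> G \<Longrightarrow> y \<in> G \<Longrightarrow> (x, y) \<notin> rel A (Base DR)"
  shows "up_closure A G \<in> linked_upsets A"
proof -
  obtain \<phi> where "\<forall>t. \<forall>x\<in>carrier A. \<forall>y\<in>carrier A.
      (x, y) \<in> rel A (Base t) \<longleftrightarrow> set_rel t (\<phi> x) (\<phi> y)"
    by (rule ordered_class_representation[OF A])
  then have \<phi>: "(x, y) \<in> rel A (Base t) \<longleftrightarrow> set_rel t (\<phi> x) (\<phi> y)"
    if "x \<in> carrier A" "y \<in> carrier A" for t x y using that by blast
  have carr: "up_closure A G \<subseteq> carrier A"
    using G ordered_class_rel_carrier[OF A] by (auto simp: up_closure_def)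
  have base: "\<exists>x\<in>G. x \<in> carrier A \<and> \<phi> x \<subseteq> \<phi> y" if y: "y \<in> up_closure A G" for y
  proof -
    obtain x where x: "x \<in> G" "x = y \<or> (x, y) \<in> rel A (Base PP)"
      using y unfolding up_closure_def by blast
    then have "x \<in> carrier A" "y \<in> carrier A" using G y carr by auto
    then show ?thesis using x \<phi>[of x y PP] by auto
  qed
  have "z \<in> up_closure A G" if yz: "y \<in> up_closure A G" "(y, z) \<in> rel A (Base PP)" for y z
  proof (cases "y \<in> G")
    case False
    then obtain x where x: "x \<in> G" "(x, y) \<in> rel A (Base PP)"
      using yz(1) by (auto simp: up_closure_def)
    have "x \<in> carrier A" "y \<in> carrier A" "z \<in> carrier A"
      using x(2) yz(2) ordered_class_rel_carrier[OF A] by blast+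
    then have "(x, z) \<in> rel A (Base PP)" using x(2) yz(2) by (auto simp: \<phi>)
    then show ?thesis using x(1) by (auto simp: up_closure_def)
  qed (use yz(2) in \<open>auto simp: up_closure_def\<close>)
  moreover have "(y, z) \<notin> rel A (Base DR)" if yz: "y \<in> up_closure A G" "z \<in> up_closure A G" for y z
  proof -
    obtain a b where ab: "a \<in> G" "b \<in> G" "\<phi> a \<subseteq> \<phi> y" "\<phi> b \<subseteq> \<phi> z" using base yz by blast
    then have "\<phi> a \<inter> \<phi> b \<noteq> {}" using linked[OF ab(1,2)] \<phi>[of a b DR] G by auto
    then have "\<phi> y \<inter> \<phi> z \<noteq> {}" using ab(3,4) by blast
    then show ?thesis using \<phi>[of y z DR] yz carr by auto
  qed
  ultimately show ?thesis using carr by (auto simp: linked_upsets_def)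
qed

text \<open>
  The enumeration identifies the linked upsets with the letters of a rigid surjection.
\<close>

definition upset_enumeration :: "(ordered_rcc5, 'a) bstruct \<Rightarrow> 'a set list \<Rightarrow> bool" where
  "upset_enumeration A Fs \<longleftrightarrow> set Fs = linked_upsets A \<and> distinct Fs \<and>
     sorted_wrt (\<lambda>F G. (F, G) \<in> lex_order (rel A Prec) (carrier A)) Fs"

lemma ex_upset_enumeration:
  assumes "A \<in> ordered_class"
  obtains Fs where "upset_enumeration A Fs"
proof -
  note ord = ordered_class_order[OF assms]
  have sub: "linked_upsets A \<subseteq> Pow (carrier A)" by (auto simp: linked_upsets_def)
  have "finite (linked_upsets A)" using finite_subset[OF sub] ord(1) by simp
  moreover have "total_on (linked_upsets A) (lex_order (rel A Prec) (carrier A))"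
    unfolding total_on_def using sub lex_order_total[OF ord(6)] by (metis PowD subsetD)
  ultimately obtain Fs where "upset_enumeration A Fs"
    unfolding upset_enumeration_def
    using sorted_enumeration[OF _ trans_lex_order[OF ord(2,4)] irrefl_lex_order] by blast
  then show ?thesis by (rule that)
qed

lemma upset_index_less:
  assumes "A \<in> ordered_class" "upset_enumeration A Fs" "i < length Fs" "j < length Fs"
    and "(Fs ! i, Fs ! j) \<in> lex_order (rel A Prec) (carrier A)"
  shows "i < j"
proof (rule sorted_index_less[OF _ trans_lex_order irrefl_lex_order])
  show "sorted_wrt (\<lambda>F G. (F, G) \<in> lex_order (rel A Prec) (carrier A)) Fs"
    using assms(2) by (simp add: upset_enumeration_def)
qed (use assms ordered_class_order[OF assms(1)] in simp_all)

section \<open>Words as embeddings\<close>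

text \<open>
  The nonempty subsets of \<open>{..<n}\<close>, coded as natural numbers, with the lexicographic order.
\<close>

definition powerset_structure :: "nat \<Rightarrow> (ordered_rcc5, nat) bstruct" where
  "powerset_structure n =
     (let V = {k. set_decode k \<subseteq> {..<n} \<and> set_decode k \<noteq> {}} in
      \<lparr>carrier = V,
       rel = (\<lambda>s. {(k, l). k \<in> V \<and> l \<in> V \<and>
         (case s of Base t \<Rightarrow> set_rel t (set_decode k) (set_decode l)
          | Prec \<Rightarrow> (set_decode k, set_decode l) \<in> lex_order less_than {..<n})})\<rparr>)"

lemma carrier_powerset_structure:
  "carrier (powerset_structure n) = {k. set_decode k \<subseteq> {..<n} \<and> set_decode k \<noteq> {}}"
  by (simp add: powerset_structure_def)

lemma rel_powerset_structure:
  "(k, l) \<in> rel (powerset_structure n) (Base t) \<longleftrightarrow> k \<in> carrier (powerset_structure n) \<and>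
     l \<in> carrier (powerset_structure n) \<and> set_rel t (set_decode k) (set_decode l)"
  "(k, l) \<in> rel (powerset_structure n) Prec \<longleftrightarrow> k \<in> carrier (powerset_structure n) \<and>
     l \<in> carrier (powerset_structure n) \<and> (set_decode k, set_decode l) \<in> lex_order less_than {..<n}"
  by (auto simp: powerset_structure_def)

lemma inj_set_decode: "inj set_decode"
  by (metis injI set_decode_inverse)

lemma lex_order_less_than:
  "trans (lex_order less_than {..<n})" "irrefl (lex_order less_than {..<n})"
  by (rule trans_lex_order) (auto simp: irrefl_lex_order total_on_def)

lemma powerset_structure_in_class: "powerset_structure n \<in> ordered_class"
proof -
  let ?C = "powerset_structure n"
  have "carrier ?C \<subseteq> set_encode ` Pow {..<n}"
  proof
    fix k assume "k \<in> carrier ?C"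
    then show "k \<in> set_encode ` Pow {..<n}"
      by (intro image_eqI[of _ _ "set_decode k"]) (auto simp: carrier_powerset_structure)
  qed
  then have "finite (carrier ?C)" by (rule finite_subset) simp
  moreover have "restrict set_decode (carrier ?C) \<in> embeddings (rcc5_reduct ?C) set_structure"
    using inj_set_decode
    by (auto simp: embeddings_def rcc5_reduct_def set_structure_def rel_powerset_structure
        carrier_powerset_structure inj_on_def)
  moreover have struct: "is_structure ?C"
  proof -
    have "(k, l) \<in> rel ?C s \<Longrightarrow> k \<in> carrier ?C \<and> l \<in> carrier ?C" for k l s
      by (cases s) (auto simp: rel_powerset_structure)
    then show ?thesis by (auto simp: is_structure_def)
  qed
  moreover have "is_structure (rcc5_reduct ?C)"
    using struct by (auto simp: is_structure_def rcc5_reduct_def)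
  ultimately have "is_structure ?C" "rcc5_reduct ?C \<in> age set_structure"
    by (auto simp: age_def rcc5_reduct_def)
  moreover have "strict_linear_order_on (carrier ?C) (rel ?C Prec)"
    unfolding strict_linear_order_on_def
  proof (intro conjI)
    show "trans (rel ?C Prec)"
      using lex_order_less_than(1)[of n] by (auto simp: trans_def rel_powerset_structure)
    show "irrefl (rel ?C Prec)"
      using lex_order_less_than(2)[of n] by (auto simp: irrefl_def rel_powerset_structure)
    show "total_on (carrier ?C) (rel ?C Prec)"
      unfolding total_on_def
    proof (intro ballI impI)
      fix k l assume kl: "k \<in> carrier ?C" "l \<in> carrier ?C" "k \<noteq> l"
      then have "set_decode k \<noteq> set_decode l" using injD[OF inj_set_decode] by blast
      then show "(k, l) \<in> rel ?C Prec \<or> (l, k) \<in> rel ?C Prec"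
        using lex_order_total[OF wf_less_than, of "set_decode k" "{..<n}" "set_decode l"] kl
        by (simp add: rel_powerset_structure) (simp add: carrier_powerset_structure)
    qed
  qed
  moreover have "rel ?C (Base PP) \<subseteq> rel ?C Prec"
    using psubset_lex_order[OF wf_less_than]
    by (auto simp: rel_powerset_structure carrier_powerset_structure)
  ultimately show ?thesis by (simp add: ordered_class_def)
qed

text \<open>
  The word \<open>w\<close> chooses a linked upset for each point \<open>i\<close>, namely the set of those elements that
  are to contain \<open>i\<close>.
\<close>

definition word_embedding :: "(ordered_rcc5, 'a) bstruct \<Rightarrow> 'a set list \<Rightarrow> nat list \<Rightarrow> 'a \<Rightarrow> nat" where
  "word_embedding A Fs w = (\<lambda>x\<in>carrier A. set_encode {i. i < length w \<and> x \<in> Fs ! (w ! i)})"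

text \<open>
  Inclusion and disjointness are respected because every linked upset is used, in particular those
  generated by one element or by two elements that are not disjoint. For the order let \<open>x\<close> precede \<open>y\<close>
  and let \<open>i\<close> be the first point that separates their images. If the upset at \<open>i\<close> contained \<open>x\<close>
  and not \<open>y\<close>, then the upset generated by \<open>y\<close>, which omits \<open>x\<close>, would be smaller, because its
  elements contain \<open>y\<close> and therefore come after \<open>x\<close>. By rigidity it would have occurred
  before \<open>i\<close>, and would have separated \<open>x\<close> and \<open>y\<close> there.
\<close>

lemma word_embedding:
  assumes A: "A \<in> ordered_class" and Fs: "upset_enumeration A Fs"
    and w: "pword 0 w (length Fs)" "length w = n"
  shows "word_embedding A Fs w \<in> embeddings A (powerset_structure n)"
proof -
  note ord = ordered_class_order[OF A]
  let ?lex = "lex_order (rel A Prec) (carrier A)"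
  obtain \<phi> where ne': "\<forall>x\<in>carrier A. \<phi> x \<noteq> {}" and inj: "inj_on \<phi> (carrier A)"
    and \<phi>': "\<forall>t. \<forall>x\<in>carrier A. \<forall>y\<in>carrier A.
      (x, y) \<in> rel A (Base t) \<longleftrightarrow> set_rel t (\<phi> x) (\<phi> y)"
    by (rule ordered_class_representation[OF A])
  have ne: "\<phi> x \<noteq> {}" if "x \<in> carrier A" for x using that ne' by blast
  have \<phi>: "(x, y) \<in> rel A (Base t) \<longleftrightarrow> set_rel t (\<phi> x) (\<phi> y)"
    if "x \<in> carrier A" "y \<in> carrier A" for t x y using that \<phi>' by blast
  define E where "E x = {i. i < n \<and> x \<in> Fs ! (w ! i)}" for x
  have up: "Fs ! (w ! i) \<in> linked_upsets A" if "i < n" for i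
    using that w Fs pword_letter_less[OF w(1)] by (metis nth_mem upset_enumeration_def)
  have occurs: "\<exists>i<n. Fs ! (w ! i) = F" if F: "F \<in> linked_upsets A" for F
  proof -
    obtain j where j: "j < length Fs" "Fs ! j = F"
      using F Fs by (metis in_set_conv_nth upset_enumeration_def)
    then have "j \<in> set w" using pword_surj[OF w(1)] by simp
    then show ?thesis using j(2) w(2) by (metis in_set_conv_nth)
  qed
  have up_single: "up_closure A {x} \<in> linked_upsets A" if "x \<in> carrier A" for x
    using that ne \<phi>[of x x DR] by (intro up_closure_linked_upset[OF A]) auto
  have le_iff: "y \<in> up_closure A {x} \<longleftrightarrow> \<phi> x \<subseteq> \<phi> y" if "x \<in> carrier A" "y \<in> carrier A" for x y
    using that \<phi>[of x y PP] inj_onD[OF inj, of x y] by (auto simp: up_closure_def)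
  have subset_iff: "E x \<subseteq> E y \<longleftrightarrow> \<phi> x \<subseteq> \<phi> y" if xy: "x \<in> carrier A" "y \<in> carrier A" for x y
  proof
    assume sub: "E x \<subseteq> E y"
    obtain i where "i < n" "Fs ! (w ! i) = up_closure A {x}" using occurs up_single xy(1) by blast
    then have "y \<in> up_closure A {x}" using sub by (auto simp: E_def up_closure_def)
    then show "\<phi> x \<subseteq> \<phi> y" using le_iff xy by simp
  next
    assume "\<phi> x \<subseteq> \<phi> y"
    then have "x = y \<or> (x, y) \<in> rel A (Base PP)" using \<phi>[of x y PP] xy inj_onD[OF inj, of x y] by auto
    then have "y \<in> F" if "F \<in> linked_upsets A" "x \<in> F" for F
      using that by (auto simp: linked_upsets_def)
    then show "E x \<subseteq> E y" using up by (auto simp: E_def)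
  qed
  have disjoint_iff: "E x \<inter> E y = {} \<longleftrightarrow> \<phi> x \<inter> \<phi> y = {}" if xy: "x \<in> carrier A" "y \<in> carrier A" for x y
  proof
    assume "\<phi> x \<inter> \<phi> y = {}"
    then have "(x, y) \<in> rel A (Base DR)" using \<phi>[of x y DR] xy by simp
    then have "\<not> (x \<in> F \<and> y \<in> F)" if "F \<in> linked_upsets A" for F
      using that by (auto simp: linked_upsets_def)
    then show "E x \<inter> E y = {}" using up by (auto simp: E_def)
  next
    assume E: "E x \<inter> E y = {}"
    show "\<phi> x \<inter> \<phi> y = {}"
    proof (rule ccontr)
      assume "\<phi> x \<inter> \<phi> y \<noteq> {}"
      then have "up_closure A {x, y} \<in> linked_upsets A"
        using xy ne \<phi>[of _ _ DR] by (intro up_closure_linked_upset[OF A]) (auto simp: Int_commute)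
      then obtain i where "i < n" "Fs ! (w ! i) = up_closure A {x, y}" using occurs by blast
      then have "i \<in> E x \<inter> E y" by (auto simp: E_def up_closure_def)
      with E show False by blast
    qed
  qed
  have E_fin: "finite (E x)" "E x \<subseteq> {..<n}" for x by (auto simp: E_def)
  have E_ne: "E x \<noteq> {}" if "x \<in> carrier A" for x
    using disjoint_iff[OF that that] ne[OF that] by simp
  have prec: "(E x, E y) \<in> lex_order less_than {..<n}" if xy: "(x, y) \<in> rel A Prec" for x y
  proof -
    have carr: "x \<in> carrier A" "y \<in> carrier A" using xy ordered_class_rel_carrier[OF A] by blast+
    have not_yx: "(y, x) \<notin> rel A Prec" "x \<noteq> y"
      using xy ord(2,3) by (auto simp: irrefl_def dest: transD)
    let ?U = "up_closure A {y}"
    have U: "?U \<in> linked_upsets A" "x \<notin> ?U" "y \<in> ?U"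
      using up_single carr(2) not_yx ord(5) by (auto simp: up_closure_def)
    obtain i0 where "i0 < n" "Fs ! (w ! i0) = ?U" using occurs[OF U(1)] by blast
    then have "E x \<noteq> E y" using U(2,3) by (auto simp: E_def)
    then consider "(E x, E y) \<in> lex_order less_than {..<n}" | "(E y, E x) \<in> lex_order less_than {..<n}"
      using lex_order_total[OF wf_less_than E_fin(2) E_fin(2)] by blast
    then show ?thesis
    proof cases
      case 2
      then obtain i where i: "i \<in> E x - E y" "\<And>k. k < i \<Longrightarrow> k \<in> E y \<longleftrightarrow> k \<in> E x"
        by (auto simp: lex_order_def)
      let ?F = "Fs ! (w ! i)"
      have F: "?F \<in> linked_upsets A" "x \<in> ?F" "y \<notin> ?F" "i < n" using i(1) up by (auto simp: E_def)
      have "(?U, ?F) \<in> ?lex"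
      proof (rule ccontr)
        assume "(?U, ?F) \<notin> ?lex"
        moreover have "?U \<subseteq> carrier A" "?F \<subseteq> carrier A" "?U \<noteq> ?F"
          using U F by (auto simp: linked_upsets_def)
        ultimately have "(?F, ?U) \<in> ?lex" using lex_order_total[OF ord(6)] by blast
        then obtain m where m: "m \<in> ?U - ?F" "\<And>k. (k, m) \<in> rel A Prec \<Longrightarrow> k \<in> ?F \<longleftrightarrow> k \<in> ?U"
          by (auto simp: lex_order_def)
        have "m = y \<or> (y, m) \<in> rel A Prec" using m(1) ord(5) by (auto simp: up_closure_def)
        then have "(x, m) \<in> rel A Prec" using xy ord(2) by (auto dest: transD)
        then show False using m(2) F(2) U(2) by blast
      qed
      moreover obtain j where j: "j < length Fs" "Fs ! j = ?U"
        using U(1) Fs by (metis in_set_conv_nth upset_enumeration_def)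
      moreover have "w ! i < length Fs" using F(4) w pword_letter_less by simp
      ultimately have "j < w ! i" using upset_index_less[OF A Fs] by simp
      then obtain k where k: "k < i" "w ! k = j"
        using pword_first_occurrences_increasing[OF w(1), of i j] F(4) w(2) by auto
      then have "k \<in> E y" "k \<notin> E x" using j U F(4) by (auto simp: E_def)
      then show ?thesis using i(2)[OF k(1)] by simp
    qed
  qed
  have prec_iff: "(x, y) \<in> rel A Prec \<longleftrightarrow> (E x, E y) \<in> lex_order less_than {..<n}"
    if xy: "x \<in> carrier A" "y \<in> carrier A" for x y
  proof
    assume lex: "(E x, E y) \<in> lex_order less_than {..<n}"
    show "(x, y) \<in> rel A Prec"
    proof (rule ccontr)
      assume "(x, y) \<notin> rel A Prec"
      then have "x = y \<or> (y, x) \<in> rel A Prec" using xy ord(4) by (auto simp: total_on_def)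
      then have "(E x, E x) \<in> lex_order less_than {..<n}"
        using lex prec lex_order_less_than(1)[of n] by (auto dest: transD)
      then show False using lex_order_less_than(2)[of n] by (auto simp: irrefl_def)
    qed
  qed (rule prec)
  have emb: "word_embedding A Fs w x = set_encode (E x)" if "x \<in> carrier A" for x
    using that w(2) by (simp add: word_embedding_def E_def)
  have dec: "set_decode (word_embedding A Fs w x) = E x" if "x \<in> carrier A" for x
    using emb[OF that] E_fin(1) by (simp add: set_encode_inverse)
  have carr: "word_embedding A Fs w x \<in> carrier (powerset_structure n)" if "x \<in> carrier A" for x
    using dec[OF that] E_fin E_ne[OF that] by (simp add: carrier_powerset_structure)
  have "inj_on (word_embedding A Fs w) (carrier A)"
  proof (rule inj_onI)
    fix x y assume xy: "x \<in> carrier A" "y \<in> carrier A" "word_embedding A Fs w x = word_embedding A Fs w y"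
    then have "E x = E y" using dec by metis
    then have "\<phi> x = \<phi> y" using subset_iff xy(1,2) by blast
    then show "x = y" using inj_onD[OF inj] xy(1,2) by blast
  qed
  moreover have "(x, y) \<in> rel A s \<longleftrightarrow>
      (word_embedding A Fs w x, word_embedding A Fs w y) \<in> rel (powerset_structure n) s"
    if xy: "x \<in> carrier A" "y \<in> carrier A" for s x y
  proof (cases s)
    case (Base t)
    have "set_rel t (\<phi> x) (\<phi> y) \<longleftrightarrow> set_rel t (E x) (E y)"
      using xy subset_iff disjoint_iff by (intro set_rel_cong) simp_all
    then show ?thesis using xy carr dec \<phi> Base by (simp add: rel_powerset_structure)
  next
    case Prec
    then show ?thesis using xy carr dec prec_iff by (simp add: rel_powerset_structure)
  qed
  moreover have "word_embedding A Fs w \<in> carrier A \<rightarrow>\<^sub>E carrier (powerset_structure n)"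
    using carr by (auto simp: word_embedding_def)
  ultimately show ?thesis by (simp add: embeddings_def)
qed

text \<open>
  Restriction along an embedding \<open>h\<close> is a map from the linked upsets of \<open>B\<close> to those of \<open>A\<close>. It is
  surjective, because \<open>F\<close> is the restriction of the upset \<open>ext F\<close> that \<open>h ` F\<close> generates. It is
  rigid, because \<open>ext F\<close> precedes every \<open>G\<close> whose restriction is larger than \<open>F\<close>: that is
  \<open>ext_least\<close>. If the least difference between \<open>G\<close> and \<open>ext F\<close> were an element \<open>m\<close> of \<open>ext F\<close>,
  then \<open>m\<close> would lie above some \<open>h a\<close> with \<open>a \<in> F - pull G\<close>, and before \<open>h z\<close> where \<open>z\<close> is the least
  difference between \<open>F\<close> and the restriction of \<open>G\<close>; so \<open>a\<close> would be a smaller difference.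
\<close>

lemma restriction_word:
  assumes A: "A \<in> ordered_class" and B: "B \<in> ordered_class"
    and Fs: "upset_enumeration A Fs" and Gs: "upset_enumeration B Gs"
    and h: "h \<in> embeddings A B"
  obtains g where "pword 0 g (length Fs)" "length g = length Gs"
    "\<forall>k<length Gs. Fs ! (g ! k) = {x \<in> carrier A. h x \<in> Gs ! k}"
proof -
  note ordA = ordered_class_order[OF A] and ordB = ordered_class_order[OF B]
  have h_carr: "h x \<in> carrier B" if "x \<in> carrier A" for x
    using h that by (auto simp: embeddings_def)
  have h_rel: "(x, y) \<in> rel A s \<longleftrightarrow> (h x, h y) \<in> rel B s" if "x \<in> carrier A" "y \<in> carrier A" for s x y
    using h that by (auto simp: embeddings_def)
  have h_inj: "inj_on h (carrier A)" using h by (simp add: embeddings_def)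
  define pull where "pull G = {x \<in> carrier A. h x \<in> G}" for G
  have pull: "pull G \<in> linked_upsets A" if "G \<in> linked_upsets B" for G
    using that h_rel ordered_class_rel_carrier[OF A] unfolding linked_upsets_def pull_def by blast
  define ext where "ext F = up_closure B (h ` F)" for F
  have ext: "ext F \<in> linked_upsets B" if "F \<in> linked_upsets A" for F
    unfolding ext_def using that h_carr h_rel
    by (intro up_closure_linked_upset[OF B]) (auto simp: linked_upsets_def subset_iff)
  have pull_ext: "pull (ext F) = F" if F: "F \<in> linked_upsets A" for F
  proof -
    have "x \<in> F \<longleftrightarrow> h x \<in> ext F" if x: "x \<in> carrier A" for x
    proof
      assume "h x \<in> ext F"
      then obtain a where a: "a \<in> F" "h a = h x \<or> (h a, h x) \<in> rel B (Base PP)"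
        by (auto simp: ext_def up_closure_def)
      then have "a \<in> carrier A" using F by (auto simp: linked_upsets_def)
      then have "a = x \<or> (a, x) \<in> rel A (Base PP)" using a(2) x h_rel h_inj by (auto dest: inj_onD)
      then show "x \<in> F" using a(1) F by (auto simp: linked_upsets_def)
    qed (auto simp: ext_def up_closure_def)
    moreover have "F \<subseteq> carrier A" using F by (auto simp: linked_upsets_def)
    ultimately show ?thesis by (auto simp: pull_def)
  qed
  have ext_least: "(ext F, G) \<in> lex_order (rel B Prec) (carrier B)"
    if F: "F \<in> linked_upsets A" and G: "G \<in> linked_upsets B"
      and lex: "(F, pull G) \<in> lex_order (rel A Prec) (carrier A)" for F G
  proof (rule ccontr)
    assume not: "(ext F, G) \<notin> lex_order (rel B Prec) (carrier B)"
    have "F \<noteq> pull G" using lex irrefl_lex_order by (auto simp: irrefl_def)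
    then have "ext F \<noteq> G" using pull_ext[OF F] by blast
    moreover have "ext F \<subseteq> carrier B" "G \<subseteq> carrier B" using ext[OF F] G by (auto simp: linked_upsets_def)
    ultimately have "(G, ext F) \<in> lex_order (rel B Prec) (carrier B)"
      using lex_order_total[OF ordB(6)] not by blast
    then obtain m where m: "m \<in> ext F - G" "\<And>k. (k, m) \<in> rel B Prec \<Longrightarrow> k \<in> G \<longleftrightarrow> k \<in> ext F"
      by (auto simp: lex_order_def)
    obtain z where z: "z \<in> pull G - F" "\<And>y. (y, z) \<in> rel A Prec \<Longrightarrow> y \<in> F \<longleftrightarrow> y \<in> pull G"
      using lex by (auto simp: lex_order_def)
    have hz: "z \<in> carrier A" "h z \<in> G" "h z \<notin> ext F"
      using z(1) pull_ext[OF F] by (auto simp: pull_def)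
    obtain a where a: "a \<in> F" "h a = m \<or> (h a, m) \<in> rel B (Base PP)"
      using m(1) by (auto simp: ext_def up_closure_def)
    have "a \<in> carrier A" using a(1) F by (auto simp: linked_upsets_def)
    have "h a \<notin> G" using a(2) m(1) G by (auto simp: linked_upsets_def)
    then have "a \<notin> pull G" by (simp add: pull_def)
    have "m \<in> carrier B" using m(1) ext[OF F] by (auto simp: linked_upsets_def)
    moreover have "(h z, m) \<notin> rel B Prec" using m(2) hz by blast
    moreover have "h z \<noteq> m" using m(1) hz by blast
    ultimately have "(m, h z) \<in> rel B Prec"
      using ordB(4) h_carr[OF hz(1)] by (auto simp: total_on_def)
    then have "(h a, h z) \<in> rel B Prec"
      using a(2) ordB(2,5) by (auto dest: transD)
    then have "(a, z) \<in> rel A Prec" using h_rel \<open>a \<in> carrier A\<close> hz(1) by blast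
    then show False using z(2) a(1) \<open>a \<notin> pull G\<close> by blast
  qed
  have "\<exists>j. j < length Fs \<and> Fs ! j = F" if "F \<in> linked_upsets A" for F
    using that Fs by (metis in_set_conv_nth upset_enumeration_def)
  then obtain idx where idx: "\<And>F. F \<in> linked_upsets A \<Longrightarrow> idx F < length Fs \<and> Fs ! idx F = F"
    by metis
  have Fs_nth: "Fs ! j \<in> linked_upsets A" "idx (Fs ! j) = j" if "j < length Fs" for j
  proof -
    show "Fs ! j \<in> linked_upsets A" using that Fs by (metis nth_mem upset_enumeration_def)
    from idx[OF this] show "idx (Fs ! j) = j"
      using that Fs by (auto simp: upset_enumeration_def nth_eq_iff_index_eq)
  qed
  have Gs_nth: "Gs ! k \<in> linked_upsets B" if "k < length Gs" for k
    using that Gs by (metis nth_mem upset_enumeration_def)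
  have Gs_idx: "\<exists>k<length Gs. Gs ! k = G" if "G \<in> linked_upsets B" for G
    using that Gs by (metis in_set_conv_nth upset_enumeration_def)
  define g where "g = map (\<lambda>G. idx (pull G)) Gs"
  have g_nth: "g ! k < length Fs" "Fs ! (g ! k) = pull (Gs ! k)" if "k < length Gs" for k
    using that idx[OF pull[OF Gs_nth[OF that]]] by (auto simp: g_def)
  have ext_idx: "\<exists>k<length Gs. Gs ! k = ext (Fs ! j) \<and> g ! k = j" if j: "j < length Fs" for j
  proof -
    obtain k where k: "k < length Gs" "Gs ! k = ext (Fs ! j)"
      using Gs_idx ext Fs_nth(1)[OF j] by blast
    then have "g ! k = j" using pull_ext Fs_nth[OF j] by (simp add: g_def)
    with k show ?thesis by blast
  qed
  have "pword 0 g (length Fs)"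
  proof (rule pwordI)
    show "x < length Fs" if "x \<in> set g" for x
      using that g_nth(1) by (auto simp: in_set_conv_nth g_def)
    show "j \<in> set g" if "j < length Fs" for j
      using ext_idx[OF that] by (metis g_def length_map nth_mem)
    show "\<exists>k'<k. g ! k' = j" if kj: "k < length g" "j < g ! k" for k j
    proof -
      have k: "k < length Gs" using kj(1) by (simp add: g_def)
      then have j: "j < length Fs" using g_nth(1) kj(2) less_trans by blast
      obtain k' where k': "k' < length Gs" "Gs ! k' = ext (Fs ! j)" "g ! k' = j"
        using ext_idx[OF j] by blast
      have "(Fs ! j, Fs ! (g ! k)) \<in> lex_order (rel A Prec) (carrier A)"
        using Fs kj(2) g_nth(1)[OF k] by (simp add: upset_enumeration_def sorted_wrt_iff_nth_less)
      then have "(ext (Fs ! j), Gs ! k) \<in> lex_order (rel B Prec) (carrier B)"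
        using g_nth(2)[OF k] by (intro ext_least Fs_nth(1)[OF j] Gs_nth[OF k]) simp
      then have "k' < k" using upset_index_less[OF B Gs k'(1) k] k'(2) by simp
      then show ?thesis using k'(3) by blast
    qed
  qed simp
  then show ?thesis using g_nth(2) by (intro that[of g]) (auto simp: g_def pull_def)
qed

section \<open>The Ramsey property\<close>

text \<open>
  Restricting an embedding of \<open>B\<close> along \<open>h\<close> corresponds to composing rigid surjections.
\<close>

lemma compose_word_embedding:
  assumes "pword 0 f (length Gs)" "h \<in> embeddings A B" "length g = length Gs"
    and "\<forall>k<length Gs. Fs ! (g ! k) = {x \<in> carrier A. h x \<in> Gs ! k}"
  shows "compose (carrier A) (word_embedding B Gs f) h = word_embedding A Fs (subst 0 g f)"
proof
  fix x
  show "compose (carrier A) (word_embedding B Gs f) h x = word_embedding A Fs (subst 0 g f) x"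
  proof (cases "x \<in> carrier A")
    case True
    then have "h x \<in> carrier B" using assms(2) by (auto simp: embeddings_def)
    moreover have "x \<in> Fs ! (subst 0 g f ! i) \<longleftrightarrow> h x \<in> Gs ! (f ! i)" if "i < length f" for i
      using that True assms(4) pword_letter_less[OF assms(1), of "f ! i"] by (simp add: subst_def)
    ultimately show ?thesis using True by (auto simp: compose_def word_embedding_def intro!: arg_cong[where f = set_encode])
  qed (simp add: compose_def word_embedding_def)
qed

theorem ordered_class_ramsey: "ramsey_property ordered_class"
  unfolding ramsey_property_def
proof (intro ballI allI)
  fix A B :: "(ordered_rcc5, nat) bstruct" and r :: nat
  assume A: "A \<in> ordered_class" and B: "B \<in> ordered_class"
  obtain Fs Gs where Fs: "upset_enumeration A Fs" and Gs: "upset_enumeration B Gs"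
    using ex_upset_enumeration A B by metis
  obtain n where n: "monochromatic_subspace 0 (length Fs) (length Gs) {0..r} n"
    using graham_rothschild[of "{0..r}" 0 "length Fs" "length Gs"] by auto
  have "ramsey_arrow (powerset_structure n) B A r"
    unfolding ramsey_arrow_def
  proof
    fix \<chi> assume \<chi>: "\<chi> \<in> embeddings A (powerset_structure n) \<rightarrow> {1..r}"
    \<comment> \<open>The additional colour \<open>0\<close> keeps the set of colours nonempty in case that \<open>r = 0\<close>.\<close>
    have col: "\<chi> (word_embedding A Fs w) \<in> {0..r}" if "pword 0 w (length Fs)" "length w = n" for w
      using word_embedding[OF A Fs that] \<chi> by (fastforce simp: Pi_iff)
    obtain f \<kappa> where f: "pword 0 f (0 + length Gs)" "length f = n"
      and \<kappa>: "\<forall>g. pword 0 g (length Fs) \<and> length g = length Gs \<longrightarrow>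
        \<chi> (word_embedding A Fs (subst 0 g f)) = \<kappa>"
      by (rule monochromatic_subspaceE[OF n, of "\<lambda>w. \<chi> (word_embedding A Fs w)", OF col])
    let ?e = "word_embedding B Gs f"
    have f': "pword 0 f (length Gs)" using f(1) by simp
    have "\<chi> (compose (carrier A) ?e h) = \<kappa>" if h: "h \<in> embeddings A B" for h
    proof -
      obtain g where g: "pword 0 g (length Fs)" "length g = length Gs"
        "\<forall>k<length Gs. Fs ! (g ! k) = {x \<in> carrier A. h x \<in> Gs ! k}"
        by (rule restriction_word[OF A B Fs Gs h])
      show ?thesis using compose_word_embedding[OF f' h g(2,3)] \<kappa> g(1,2) by simp
    qed
    moreover have "?e \<in> embeddings B (powerset_structure n)"
      using word_embedding[OF B Gs f' f(2)] .
    ultimately show "\<exists>e\<in>embeddings B (powerset_structure n).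
        \<exists>c. \<forall>h\<in>embeddings A B. \<chi> (compose (carrier A) e h) = c" by blast
  qed
  then show "\<exists>C\<in>ordered_class. ramsey_arrow C B A r"
    using powerset_structure_in_class by blast
qed

theorem theorem9p13:
  fixes R :: "(ordered_rcc5, 'a) bstruct"
  assumes "is_fraisse_limit R ordered_class"
  shows "ramsey_structure R"
  using assms ordered_class_ramsey by (simp add: is_fraisse_limit_def ramsey_structure_def)

end
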